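(* Let $a>0$, $b>0$, $c\in(0,1)$, let $X=(X_t)_{t\ge0}$ be the tempered stable subordinator with parameters $(a,b;c)$, and let $\tilde X_t=\frac1t\int_0^t X_s\,\mathrm{d}s$ for $t>0$. Then for every $t>0$ and every $x>0$ the cumulative distribution function $F_{\tilde X_t}(x)=\mathbb{P}\{\tilde X_t\le x\}$ satisfies $$F_{\tilde X_t}(x)=1-\frac{e^{-atb^{c}\Gamma(-c)}}{\pi}\int_0^1\frac{1}{y}\exp\left(-atb^{c}\Gamma(-c-1)\left(y+\cos(\pi c)(1-y)\left(\tfrac1y-1\right)^{c}\right)-\frac{bx}{y}\right)\sin\left(atb^{c}\sin(\pi c)\Gamma(-c-1)(1-y)\left(\tfrac1y-1\right)^{c}\right)\mathrm{d}y.$$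
   Context: For $a>0$, $b>0$, $c\in(0,1)$, the tempered stable subordinator with parameters $(a,b;c)$ is the (càdlàg, nondecreasing) Lévy process $X=(X_t)_{t\ge0}$, $X_0=0$ a.s., with marginal Laplace transform $\mathbb{E}e^{-uX_t}=\exp\left(at\,\Gamma(-c)\left((b+u)^c-b^c\right)\right)$ for $\mathrm{Re}\,u>-b$ (principal branches). $\Gamma(\cdot)$ is the gamma function. *)

theory Defs
  imports "HOL-Probability.Probability"
begin

definition cadlag :: "(real \<Rightarrow> real) \<Rightarrow> bool" where
  "cadlag f \<longleftrightarrow>
     (\<forall>t\<ge>0. (f \<longlongrightarrow> f t) (at_right t)) \<and>
     (\<forall>t>0. \<exists>l. (f \<longlongrightarrow> l) (at_left t))"

text \<open>
  Only times \<open>t \<ge> 0\<close> matter; the values of \<open>X\<close> at negative times are unconstrained.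
  The path properties hold for every sample point, while \<open>X 0 = 0\<close> holds almost surely.
  Stochastic continuity is implied by right-continuity and stationarity of the increments.
\<close>

locale levy_process = prob_space M for M :: "'w measure" +
  fixes X :: "real \<Rightarrow> 'w \<Rightarrow> real"
  assumes random_variable_X: "t \<ge> 0 \<Longrightarrow> random_variable borel (X t)"
    and X_start: "AE \<omega> in M. X 0 \<omega> = 0"
    and independent_increments:
      "\<lbrakk>0 \<le> \<tau> 0; \<And>i. i < n \<Longrightarrow> \<tau> i < \<tau> (Suc i)\<rbrakk> \<Longrightarrow>
         indep_vars (\<lambda>_. borel) (\<lambda>i \<omega>. X (\<tau> (Suc i)) \<omega> - X (\<tau> i) \<omega>) {..<n::nat}"
    and stationary_increments:
      "\<lbrakk>0 \<le> s; 0 \<le> h\<rbrakk> \<Longrightarrow>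
         distr M borel (\<lambda>\<omega>. X (s + h) \<omega> - X s \<omega>) = distr M borel (\<lambda>\<omega>. X h \<omega> - X 0 \<omega>)"
    and cadlag_paths: "\<omega> \<in> space M \<Longrightarrow> cadlag (\<lambda>t. X t \<omega>)"

locale subordinator = levy_process +
  assumes nondecreasing_paths: "\<omega> \<in> space M \<Longrightarrow> mono_on {0..} (\<lambda>t. X t \<omega>)"

text \<open>
  The Laplace transform is a Bochner integral, which is \<open>0\<close> for non-integrable functions.
  As the right-hand side never vanishes, the equation below includes integrability.
\<close>

locale tempered_stable_subordinator = subordinator +
  fixes a b c :: real
  assumes a_pos: "a > 0" and b_pos: "b > 0" and c_pos: "c > 0" and c_less_1: "c < 1"
    and laplace_transform:
      "\<lbrakk>t \<ge> 0; Re u > - b\<rbrakk> \<Longrightarrow>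
         (LINT \<omega>|M. exp (- u * complex_of_real (X t \<omega>))) =
         exp (complex_of_real (a * t * Gamma (- c)) *
           ((complex_of_real b + u) powr complex_of_real c
             - complex_of_real b powr complex_of_real c))"

definition running_average :: "(real \<Rightarrow> 'w \<Rightarrow> real) \<Rightarrow> real \<Rightarrow> 'w \<Rightarrow> real" where
  "running_average X t \<omega> = (1 / t) * (LBINT s:{0..t}. X s \<omega>)"

end

theory Submission
  imports Defs "HOL-Complex_Analysis.Complex_Analysis" "HOL-Real_Asymp.Real_Asymp"
begin

text \<open>
  The increments of \<open>X\<close> are independent, so Riemann sums of the paths give the Laplace transform of the
  average, \<open>\<Phi>(u) = exp (\<integral>\<^sub>0\<^sup>t \<psi>(u s / t) ds)\<close> with \<open>\<psi>\<close> the Laplace exponent, on the imaginary axis. In closed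
  form \<open>\<Phi>\<close> extends to the plane cut along \<open>(-\<infinity>, -b]\<close>. At a continuity point \<open>x\<close>, Levy inversion
  on \<open>(-1, x]\<close> and conjugation symmetry express the distribution function by the imaginary part of
  \<open>\<integral> (exp (x u) - exp (- u)) \<Phi>(u) / u du\<close> over the positive imaginary axis. In each of the two terms the
  path is turned onto the real axis: to the left for \<open>exp (x u)\<close>, to the right for \<open>exp (- u)\<close>. The pole at \<open>0\<close>
  contributes \<open>\<pi> / 2\<close> each time, and on the real axis the integrand has a nonzero imaginary part only on the
  cut, where \<open>u = - b / y\<close> produces the stated integral. Other \<open>x\<close> follow by right continuity.
\<close>

section \<open>Turning a contour within a quadrant\<close>

text \<open>The pole is subtracted, not indented around: each path carries
  \<open>(G - 1) / u\<close>, with \<open>G\<close> the transform times an exponential. This extends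
  continuously to 0, and the two subtracted terms cancel in the inversion integrand. The price is
  that truncated integrals along a single axis diverge logarithmically in their real part, so only
  differences and imaginary parts are passed to the limit. The value \<pi> / 2 is the change of
  argument along the hypotenuse that closes the truncated path to a triangle. The obstacle is the
  left quadrant. Its real side lies on the cut, so Cauchy's theorem must do with mere continuity on
  the closed triangle. For \<open>c > 1/2\<close> the transform also grows there; its growth
  exponent is bounded by a multiple of \<open>|Re u + b| * |u + b| powr (c - 1)\<close>, and keeping
  the factor \<open>Re u + b\<close> lets the decay of \<open>exp (x u)\<close> absorb it uniformly
  up to the imaginary axis. The lower limit -1 could be any negative number: the average is almost
  surely nonnegative, so no mass is lost and there is no atom, and strict negativity gives decay to
  the right.\<close>

lemma interior_quadrant:
  assumes "sg = 1 \<or> sg = (-1::real)"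
  shows "interior {z. 0 \<le> sg * Re z \<and> 0 \<le> Im z} = {z. 0 < sg * Re z \<and> 0 < Im z}"
proof -
  have "{z. 0 \<le> sg * Re z \<and> 0 \<le> Im z} = {z. complex_of_real sg \<bullet> z \<ge> 0} \<inter> {z. \<i> \<bullet> z \<ge> 0}"
    by (auto simp: inner_complex_def)
  moreover have "complex_of_real sg \<noteq> 0" using assms by auto
  ultimately have "interior {z. 0 \<le> sg * Re z \<and> 0 \<le> Im z} =
      {z. complex_of_real sg \<bullet> z > 0} \<inter> {z. \<i> \<bullet> z > 0}"
    using interior_halfspace_ge[of "complex_of_real sg" 0] interior_halfspace_ge[of \<i> 0]
    by (simp only: interior_Int) simp
  then show ?thesis
    by (auto simp: inner_complex_def)
qed

text \<open>Cauchy's theorem for the triangle \<open>0, sg * T, \<i> * T\<close>. Differentiability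
  is asked only in the open quadrant because for \<open>sg = -1\<close> the real side will run along
  the branch cut.\<close>

lemma quadrant_contour_eq:
  assumes sg: "sg = 1 \<or> sg = (-1::real)" and T: "T > 0"
    and cont: "continuous_on {z. 0 \<le> sg * Re z \<and> 0 \<le> Im z} H"
    and diff: "\<And>z. 0 < sg * Re z \<Longrightarrow> 0 < Im z \<Longrightarrow> H field_differentiable at z"
  shows "contour_integral (linepath 0 (\<i> * T)) H - contour_integral (linepath 0 (of_real (sg * T))) H
       = contour_integral (linepath (of_real (sg * T)) (\<i> * T)) H"
proof -
  let ?Q = "{z. 0 \<le> sg * Re z \<and> 0 \<le> Im z}"
  let ?a = "of_real (sg * T) :: complex"
  have "?Q = {z. complex_of_real sg \<bullet> z \<ge> 0} \<inter> {z. \<i> \<bullet> z \<ge> 0}"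
    by (auto simp: inner_complex_def)
  then have cQ: "convex ?Q"
    by (metis convex_Int convex_halfspace_ge)
  have sub: "convex hull {0, ?a, \<i> * T} \<subseteq> ?Q"
    using sg T by (intro hull_minimal cQ) auto
  have ch: "closed_segment 0 ?a \<subseteq> convex hull {0, ?a, \<i> * T}"
       "closed_segment ?a (\<i> * T) \<subseteq> convex hull {0, ?a, \<i> * T}"
       "closed_segment (\<i> * T) 0 \<subseteq> convex hull {0, ?a, \<i> * T}"
    by (simp_all add: segment_convex_hull hull_mono)
  have "(H has_contour_integral 0) (linepath 0 ?a +++ linepath ?a (\<i> * T) +++ linepath (\<i> * T) 0)"
  proof (rule Cauchy_theorem_triangle_cofinite[where S = "{}"])
    show "continuous_on (convex hull {0, ?a, \<i> * T}) H"
      using cont sub continuous_on_subset by blast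
    fix z assume "z \<in> interior (convex hull {0, ?a, \<i> * T}) - {}"
    then have "z \<in> interior ?Q" using interior_mono[OF sub] by auto
    then show "H field_differentiable at z"
      unfolding interior_quadrant[OF sg] using diff by auto
  qed auto
  from has_chain_integral_chain_integral3[OF this]
  have "contour_integral (linepath 0 ?a) H + contour_integral (linepath ?a (\<i> * T)) H
     + contour_integral (linepath (\<i> * T) 0) H = 0" .
  moreover have "contour_integral (linepath (\<i> * T) 0) H = - contour_integral (linepath 0 (\<i> * T)) H"
    using ch(3) sub by (intro contour_integral_reverse_linepath continuous_on_subset[OF cont]) blast
  ultimately show ?thesis by (simp add: algebra_simps)
qed

text \<open>The primitive is \<open>Ln (- \<i> * z)\<close>, whose cut is the negative imaginary
  axis. For \<open>sg = -1\<close> the path starts on the cut of \<open>Ln\<close> itself. Both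
  endpoints have modulus \<open>T\<close>, so only the change of argument survives.\<close>

lemma has_contour_integral_inverse_quadrant:
  assumes sg: "sg = 1 \<or> sg = (-1::real)" and T: "T > 0"
  shows "((\<lambda>z. 1 / z) has_contour_integral \<i> * sg * pi / 2)
     (linepath (of_real (sg * T)) (\<i> * T))"
proof -
  let ?f = "\<lambda>z. Ln (- \<i> * z)"
  have "((\<lambda>z. 1 / z) has_contour_integral ?f (pathfinish (linepath (of_real (sg * T)) (\<i> * T)))
     - ?f (pathstart (linepath (of_real (sg * T)) (\<i> * T)))) (linepath (of_real (sg * T)) (\<i> * T))"
  proof (rule contour_integral_primitive)
    fix z assume "z \<in> closed_segment (of_real (sg * T)) (\<i> * complex_of_real T)"
    then obtain r where r: "0 \<le> r" "r \<le> 1" "z = (1 - r) *\<^sub>R of_real (sg * T) + r *\<^sub>R (\<i> * T)"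
      by (auto simp: closed_segment_def)
    then have "Im z = r * T" "Re z = (1 - r) * (sg * T)" by auto
    then have "Im z \<ge> 0" "Im z > 0 \<or> Re z \<noteq> 0"
      using sg T r(1) by (cases "r = 0"; auto)+
    then have nz: "- \<i> * z \<notin> \<real>\<^sub>\<le>\<^sub>0" "z \<noteq> 0"
      by (auto simp: complex_nonpos_Reals_iff)
    show "(?f has_field_derivative 1 / z)
        (at z within closed_segment (of_real (sg * T)) (\<i> * complex_of_real T))"
      using nz by (auto intro!: derivative_eq_intros simp: field_simps)
  qed (auto)
  moreover have "?f (\<i> * T) = of_real (ln T)"
    using T by (simp add: Ln_of_real)
  moreover have "?f (of_real (sg * T)) = of_real (ln T) - \<i> * sg * pi / 2"
  proof -
    have "?f (of_real (sg * T)) = Ln (of_real T * (- \<i> * sg))" by (simp add: mult_ac)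
    also have "\<dots> = of_real (ln T) + Ln (- \<i> * sg)"
      using T sg by (subst Ln_times_of_real) (auto simp: Ln_of_real)
    also have "Ln (- \<i> * sg) = - \<i> * sg * pi / 2" using sg by auto
    finally show ?thesis using T by (simp add: Ln_of_real mult_ac del: Ln_of_real')
  qed
  ultimately show ?thesis by simp
qed

text \<open>A form of Jordan's lemma. On the hypotenuse \<open>H z = G z / z - 1 / z\<close>; the
  first term vanishes in the limit and the second gives the constant. On a straight hypotenuse
  \<open>|Re z|\<close> is linear in the parameter, so the exponential bound integrates
  exactly.\<close>

lemma quadrant_contour_limit:
  assumes sg: "sg = 1 \<or> sg = (-1::real)" and k: "k > 0"
    and cont: "continuous_on {z. 0 \<le> sg * Re z \<and> 0 \<le> Im z} H"
    and diff: "\<And>z. 0 < sg * Re z \<Longrightarrow> 0 < Im z \<Longrightarrow> H field_differentiable at z"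
    and H: "\<And>z. 0 \<le> sg * Re z \<Longrightarrow> 0 \<le> Im z \<Longrightarrow> z \<noteq> 0 \<Longrightarrow> H z = (G z - 1) / z"
    and bound: "\<And>z. 0 \<le> sg * Re z \<Longrightarrow> 0 \<le> Im z \<Longrightarrow> cmod z \<ge> N \<Longrightarrow> cmod (G z) \<le> K * exp (- k * \<bar>Re z\<bar>)"
  shows "((\<lambda>T. contour_integral (linepath 0 (\<i> * of_real T)) H
         - contour_integral (linepath 0 (of_real (sg * T))) H) \<longlongrightarrow> - \<i> * sg * pi / 2) at_top"
proof -
  let ?Q = "{z. 0 \<le> sg * Re z \<and> 0 \<le> Im z}"
  \<comment> \<open>At this point of the imaginary axis the exponential is 1, so
    \<open>bound\<close> forces \<open>K\<close> to be nonnegative.\<close>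
  have "0 \<le> K * exp (- k * \<bar>Re (\<i> * complex_of_real \<bar>N\<bar>)\<bar>)"
    by (rule order_trans[OF norm_ge_zero bound]) (simp_all add: norm_mult)
  then have K: "K \<ge> 0" by simp
  \<comment> \<open>\<open>E T\<close> is the integral of \<open>G z / z\<close> along the
    hypotenuse: adding the constant removes the contribution of \<open>- 1 / z\<close>.\<close>
  define E where "E = (\<lambda>T. contour_integral (linepath 0 (\<i> * of_real T)) H
         - contour_integral (linepath 0 (of_real (sg * T))) H + \<i> * sg * pi / 2)"
  \<comment> \<open>One coordinate of a point on the hypotenuse is at least \<open>T / 2\<close>, so
    its modulus is at least \<open>N\<close> and \<open>1 / |z| \<le> 2 / T\<close>. With the crude
    speed bound \<open>2 * T\<close> this gives the factor 4; integrating the exponential gives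
    \<open>1 / (k * T)\<close>.\<close>
  have E: "cmod (E T) \<le> 4 * K / k * (1 / T)" if T: "T > 0" "T \<ge> 2 * N" for T
  proof -
    let ?p = "linepath (of_real (sg * T)) (\<i> * complex_of_real T)"
    have p: "?p r = of_real ((1 - r) * (sg * T)) + \<i> * of_real (r * T)" for r
      by (simp add: linepath_def scaleR_conv_of_real algebra_simps)
    have ReIm: "Re (?p r) = (1 - r) * (sg * T)" "Im (?p r) = r * T" for r
      unfolding p by simp_all
    have pQ: "?p r \<in> ?Q" if "r \<in> {0..1}" for r
      unfolding mem_Collect_eq ReIm using sg T that by auto
    have absRe: "\<bar>Re (?p r)\<bar> = (1 - r) * T" if "r \<in> {0..1}" for r
      unfolding ReIm using sg T that by (auto simp: abs_mult)
    have np: "cmod (?p r) \<ge> T / 2" if r: "r \<in> {0..1}" for r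
    proof (cases "r \<le> 1/2")
      case True
      then have "T / 2 \<le> (1 - r) * T" using T by (simp add: field_simps)
      then show ?thesis using abs_Re_le_cmod[of "?p r"] absRe[OF r] by linarith
    next
      case False
      then have "T / 2 \<le> r * T" using T by (simp add: field_simps)
      then show ?thesis using abs_Im_le_cmod[of "?p r"] ReIm(2)[of r] by linarith
    qed
    have seg: "closed_segment (of_real (sg * T)) (\<i> * complex_of_real T) = ?p ` {0..1}"
      by (metis linepath_image_01)
    have ciH: "H contour_integrable_on ?p"
      using pQ unfolding seg[symmetric]
      by (intro contour_integrable_continuous_linepath continuous_on_subset[OF cont])
         (unfold seg, blast)
    have inv: "((\<lambda>z. 1 / z) has_contour_integral \<i> * sg * pi / 2) ?p"
      by (rule has_contour_integral_inverse_quadrant[OF sg T(1)])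
    have "((\<lambda>z. H z + 1 / z) has_contour_integral (contour_integral ?p H + \<i> * sg * pi / 2)) ?p"
      by (intro has_contour_integral_add inv has_contour_integral_integral ciH)
    also have "contour_integral ?p H + \<i> * sg * pi / 2 = E T"
      unfolding E_def using quadrant_contour_eq[OF sg T(1) cont diff] by simp
    finally have 1: "((\<lambda>r. (H (?p r) + 1 / ?p r) * (\<i> * T - of_real (sg * T))) has_integral E T) {0..1}"
      by (simp add: has_contour_integral_linepath)
    have 2: "((\<lambda>r. 4 * K * exp (- k * ((1 - r) * T))) has_integral
        (4 * K / (k * T) * exp (- k * ((1 - 1) * T)) - 4 * K / (k * T) * exp (- k * ((1 - 0) * T)))) {0..1}"
    proof (rule fundamental_theorem_of_calculus)
      fix r :: real
      have "((\<lambda>r. 4 * K / (k * T) * exp (- k * ((1 - r) * T))) has_real_derivative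
          4 * K / (k * T) * (exp (- k * ((1 - r) * T)) * (k * T))) (at r within {0..1})"
        by (auto intro!: derivative_eq_intros)
      then show "((\<lambda>r. 4 * K / (k * T) * exp (- k * ((1 - r) * T))) has_vector_derivative
          4 * K * exp (- k * ((1 - r) * T))) (at r within {0..1})"
        using k T by (simp add: has_real_derivative_iff_has_vector_derivative mult.assoc)
    qed simp
    have 3: "cmod ((H (?p r) + 1 / ?p r) * (\<i> * T - of_real (sg * T))) \<le> 4 * K * exp (- k * ((1 - r) * T))"
      if r: "r \<in> {0..1}" for r
    proof -
      have nz: "?p r \<noteq> 0" using np[OF r] T by auto
      have *: "H (?p r) + 1 / ?p r = G (?p r) * (1 / ?p r)"
        using H[of "?p r"] pQ[OF r] nz by (simp add: diff_divide_distrib)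
      have g: "cmod (G (?p r)) \<le> K * exp (- k * ((1 - r) * T))"
        using bound[of "?p r"] pQ[OF r] np[OF r] T absRe[OF r] by simp
      have d: "cmod (\<i> * T - of_real (sg * T)) \<le> 2 * T"
        using norm_triangle_ineq4[of "\<i> * T" "of_real (sg * T)"] sg T by (auto simp: norm_mult)
      have q: "cmod (1 / ?p r) \<le> 2 / T"
        unfolding norm_divide norm_one using frac_le[OF zero_le_one order_refl _ np[OF r]] T by simp
      have "cmod ((H (?p r) + 1 / ?p r) * (\<i> * T - of_real (sg * T)))
          \<le> (K * exp (- k * ((1 - r) * T))) * (2 / T) * (2 * T)"
        unfolding * norm_mult[of "_ * _"] norm_mult[of "G _"]
        by (rule mult_mono[OF mult_mono[OF g q] d]) (use K T in auto)
      also have "\<dots> = 4 * K * exp (- k * ((1 - r) * T))" using T by simp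
      finally show ?thesis .
    qed
    have "cmod (E T) \<le> 4 * K / (k * T) * exp (- k * ((1 - 1) * T)) - 4 * K / (k * T) * exp (- k * ((1 - 0) * T))"
      using integral_norm_bound_integral[OF has_integral_integrable[OF 1] has_integral_integrable[OF 2] 3]
      using 1 2 by (simp only: integral_unique)
    also have "\<dots> \<le> 4 * K / (k * T)" using K k T by simp
    finally show ?thesis by simp
  qed
  have "(E \<longlongrightarrow> 0) at_top"
  proof (rule Lim_null_comparison)
    show "eventually (\<lambda>T. cmod (E T) \<le> 4 * K / k * (1 / T)) at_top"
      using eventually_gt_at_top[of 0] eventually_ge_at_top[of "2 * N"]
      by eventually_elim (rule E)
    show "((\<lambda>T. 4 * K / k * (1 / T)) \<longlongrightarrow> 0) at_top"
      by real_asymp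
  qed
  then have "((\<lambda>T. E T - \<i> * sg * pi / 2) \<longlongrightarrow> 0 - \<i> * sg * pi / 2) at_top"
    by (intro tendsto_intros)
  then show ?thesis by (simp add: E_def)
qed

section \<open>The Laplace transform off and on the cut\<close>

text \<open>
  With \<open>A = a t \<Gamma>(-c-1)\<close> this is the Laplace transform of the average for \<open>u \<noteq> 0\<close>; at \<open>u = 0\<close> division
  by zero gives a junk value, not the limit \<open>1\<close>. On the cut the principal branch selects the boundary value
  from the upper half plane.
\<close>

definition avg_transform :: "real \<Rightarrow> real \<Rightarrow> real \<Rightarrow> complex \<Rightarrow> complex" where
  "avg_transform A b c u = exp (of_real A * (of_real ((c + 1) * b powr c)
     - ((of_real b + u) powr of_real (c + 1) - of_real (b powr (c + 1))) / u))"

text \<open>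
  The principal logarithm has imaginary part in \<open>(-\<pi>, \<pi>]\<close>, so it is continuous from above on its cut.
\<close>

lemma continuous_on_powr_upper:
  assumes "0 < s"
  shows "continuous_on {z. 0 \<le> Im z} (\<lambda>z. z powr complex_of_real s)"
proof -
  \<comment> \<open>Multiplication by \<open>- \<i>\<close> turns the closed upper half plane into
    the closed right one, where the power is continuous, at 0 because \<open>s > 0\<close>.\<close>
  have eq: "z powr of_real s = (- \<i> * z) powr of_real s * exp (of_real s * (\<i> * pi / 2))" if "0 \<le> Im z" for z
  proof (cases "z = 0")
    case False
    have *: "0 \<le> Im (Ln z)" using Im_Ln_pos_le[OF False] that by auto
    from * have "- (pi / 2) < Im (Ln z)" using pi_gt_zero by linarith
    then have "Ln (- \<i> * z) = Ln z - \<i> * pi / 2"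
      using False that Ln_times_simple[of "- \<i>" z] Im_Ln_pos_le[of z] Im_Ln_le_pi[of z] pi_gt_zero
      by (auto simp: algebra_simps)
    then have "Ln z = Ln (- \<i> * z) + \<i> * pi / 2" by (simp add: algebra_simps)
    then have "exp (of_real s * Ln z) = exp (of_real s * Ln (- \<i> * z) + of_real s * (\<i> * pi / 2))"
      by (simp only: distrib_left times_divide_eq_right)
    then show ?thesis using False by (simp add: powr_def exp_add)
  qed simp
  have "continuous_on {z. 0 \<le> Im z} (\<lambda>z. (- \<i> * z) powr of_real s * exp (of_real s * (\<i> * pi / 2)))"
    using assms by (intro continuous_intros) auto
  then show ?thesis by (rule continuous_on_eq) (simp only: eq mem_Collect_eq)
qed

section \<open>Growth of the transform in the upper half plane\<close>

text \<open>With \<phi> in [0, \<pi>] the argument of \<open>w\<close>, the real part is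
  \<open>|w| powr c * cos (c * \<phi>)\<close>. If \<open>Re w \<ge> 0\<close>, then
  \<open>c * \<phi> \<le> pi / 2\<close>; otherwise
  \<open>cos (c * \<phi>) \<ge> cos \<phi> = Re w / |w|\<close>. The bound fades with
  \<open>Re w\<close>, as is needed near the imaginary axis, where \<open>exp (x u)\<close> hardly
  decays.\<close>

lemma Re_powr_upper_ge:
  assumes "0 \<le> Im w" "0 < c" "c < 1"
  shows "min 0 (Re w * cmod w powr (c - 1)) \<le> Re (w powr complex_of_real c)"
proof (cases "w = 0")
  case False
  have Ln: "Re (Ln w) = ln (cmod w)" "0 \<le> Im (Ln w)" "Im (Ln w) \<le> pi"
    using False assms(1) Im_Ln_pos_le[of w] by auto
  have eq: "Re (w powr of_real c) = cmod w powr c * cos (c * Im (Ln w))"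
    using False Ln(1) by (simp add: powr_def Re_exp)
  have cw: "cos (Im (Ln w)) = Re w / cmod w"
    using False by (metis Arg_eq_Im_Ln cos_Arg)
  show ?thesis
  proof (cases "Re w \<ge> 0")
    case True
    then have "Im (Ln w) \<le> pi / 2" using Re_Ln_pos_le[OF False] by auto
    then have "c * Im (Ln w) \<le> 1 * (pi / 2)" using assms Ln by (intro mult_mono) auto
    then have "cos (c * Im (Ln w)) \<ge> 0" using assms Ln by (intro cos_ge_zero) (auto intro: order_trans[of _ 0])
    then show ?thesis unfolding eq by (intro min.coboundedI1) simp
  next
    case neg: False
    \<comment> \<open>This crude bound suffices: as \<open>c < 1\<close>, the resulting term is absorbed by \<open>exp (x u)\<close> for large \<open>u\<close>.\<close>
    have "cos (c * Im (Ln w)) \<ge> cos (Im (Ln w))"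
      using assms Ln by (intro cos_monotone_0_pi_le) (auto intro: mult_left_le_one_le)
    then have "cmod w powr c * cos (c * Im (Ln w)) \<ge> cmod w powr c * (Re w / cmod w)"
      unfolding cw by (intro mult_left_mono) auto
    also have "cmod w powr c * (Re w / cmod w) = Re w * cmod w powr (c - 1)"
      using False by (simp add: powr_diff)
    finally show ?thesis unfolding eq by (intro min.coboundedI2)
  qed
qed (use assms in simp)

text \<open>With \<open>w = b + u\<close>, the identity
  \<open>w powr (c + 1) = u * w powr c + b * w powr c\<close> splits the quotient into
  \<open>w powr c\<close> and a remainder. For \<open>|u| \<ge> 1\<close> the remainder is bounded,
  since \<open>|w| powr c \<le> 1 + |w| \<le> (2 + b) * |u|\<close>.\<close>

lemma norm_avg_transform_le:
  assumes "0 \<le> Im u" "1 \<le> cmod u" "0 < c" "c < 1" "0 < b" "0 < A"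
  shows "cmod (avg_transform A b c u) \<le>
     exp (A * ((c + 1) * b powr c + b * (2 + b) + b powr (c + 1))) *
     exp (A * max 0 (- (Re u + b) * cmod (of_real b + u) powr (c - 1)))"
proof -
  define w where "w = of_real b + u"
  have u: "u \<noteq> 0" using assms by auto
  have "w powr of_real (c + 1) = w * w powr of_real c"
    by (cases "w = 0") (simp_all add: powr_add mult.commute)
  also have "\<dots> = u * w powr of_real c + of_real b * w powr of_real c"
    unfolding w_def by (simp add: algebra_simps)
  finally have "(w powr of_real (c + 1) - of_real (b powr (c + 1))) / u
      = w powr of_real c + (of_real b * w powr of_real c - of_real (b powr (c + 1))) / u"
    using u by (simp add: field_simps)
  moreover have "cmod ((of_real b * w powr of_real c - of_real (b powr (c + 1))) / u) \<le> b * (2 + b) + b powr (c + 1)"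
  proof -
    have "cmod w \<le> b + cmod u" unfolding w_def using norm_triangle_ineq[of "of_real b" u] assms by simp
    moreover have "cmod w powr c \<le> 1 + cmod w"
    proof (cases "cmod w \<le> 1")
      case True
      then have "cmod w powr c \<le> 1 powr c" using assms by (intro powr_mono2) auto
      then have "cmod w powr c \<le> 1" by simp
      then show ?thesis using norm_ge_zero[of w] by linarith
    next
      case False
      then have "cmod w powr c \<le> cmod w powr 1" using assms by (intro powr_mono) auto
      then show ?thesis using False by simp
    qed
    moreover have "b \<le> b * cmod u" using assms by simp
    moreover have "(2 + b) * cmod u = 2 * cmod u + b * cmod u" by (simp add: algebra_simps)
    ultimately have "cmod w powr c \<le> (2 + b) * cmod u" using assms by linarith
    then have 1: "b * cmod w powr c \<le> b * (2 + b) * cmod u" using assms by simp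
    have 2: "b powr (c + 1) \<le> b powr (c + 1) * cmod u" using assms by simp
    have "cmod (of_real b * w powr of_real c - of_real (b powr (c + 1))) \<le> b * cmod w powr c + b powr (c + 1)"
      using norm_triangle_ineq4[of "of_real b * w powr of_real c" "of_real (b powr (c + 1))"] assms
      by (cases "w = 0") (simp_all add: norm_mult norm_powr_real_powr')
    also have "\<dots> \<le> (b * (2 + b) + b powr (c + 1)) * cmod u" using 1 2 by (simp add: algebra_simps)
    finally show ?thesis using assms u by (simp add: norm_divide pos_divide_le_eq)
  qed
  ultimately have "Re ((w powr of_real (c + 1) - of_real (b powr (c + 1))) / u)
      \<ge> Re (w powr of_real c) - (b * (2 + b) + b powr (c + 1))"
    using abs_Re_le_cmod[of "(of_real b * w powr of_real c - of_real (b powr (c + 1))) / u"] by simp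
  moreover have "Re (w powr of_real c) \<ge> min 0 (Re w * cmod w powr (c - 1))"
    using assms by (intro Re_powr_upper_ge) (auto simp: w_def)
  moreover have "min 0 (Re w * cmod w powr (c - 1)) = - max 0 (- Re w * cmod w powr (c - 1))"
    by (simp add: max_def min_def)
  ultimately have "(c + 1) * b powr c - Re ((w powr of_real (c + 1) - of_real (b powr (c + 1))) / u)
     \<le> ((c + 1) * b powr c + b * (2 + b) + b powr (c + 1)) + max 0 (- Re w * cmod w powr (c - 1))"
    by linarith
  then have "A * ((c + 1) * b powr c - Re ((w powr of_real (c + 1) - of_real (b powr (c + 1))) / u))
     \<le> A * (((c + 1) * b powr c + b * (2 + b) + b powr (c + 1)) + max 0 (- Re w * cmod w powr (c - 1)))"
    using assms by (intro mult_left_mono) auto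
  moreover have "cmod (avg_transform A b c u) =
     exp (A * ((c + 1) * b powr c - Re ((w powr of_real (c + 1) - of_real (b powr (c + 1))) / u)))"
    unfolding avg_transform_def norm_exp_eq_Re w_def[symmetric]
    by (simp only: Re_complex_of_real minus_complex.sel times_complex.sel Im_complex_of_real mult_zero_left diff_zero)
  ultimately show ?thesis
    by (simp add: exp_add[symmetric] distrib_left w_def add.commute)
qed

lemma norm_avg_transform_right:
  assumes "0 \<le> Re u" "0 \<le> Im u" "1 \<le> cmod u" "0 < c" "c < 1" "0 < b" "0 < A"
  shows "cmod (avg_transform A b c u) \<le> exp (A * ((c + 1) * b powr c + b * (2 + b) + b powr (c + 1)))"
proof -
  have "- (Re u + b) * cmod (of_real b + u) powr (c - 1) \<le> 0"
    using assms by (intro mult_nonpos_nonneg) auto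
  then show ?thesis using norm_avg_transform_le[of u c b A] assms by (simp add: max_absorb1)
qed

text \<open>As \<open>c < 1\<close>, far out \<open>A * |b + u| powr (c - 1) \<le> x / 2\<close>, so
  the growth of the transform uses up at most half of the decay rate \<open>x\<close>; the other
  half remains.\<close>

lemma norm_avg_transform_left:
  assumes "0 < c" "c < 1" "0 < b" "0 < A" "0 < x"
  obtains N where "\<And>u. Re u \<le> 0 \<Longrightarrow> 0 \<le> Im u \<Longrightarrow> N \<le> cmod u \<Longrightarrow>
     cmod (exp (of_real x * u) * avg_transform A b c u) \<le>
       exp (A * ((c + 1) * b powr c + b * (2 + b) + b powr (c + 1))) * exp (- (x / 2) * \<bar>Re u\<bar>)"
proof -
  let ?K = "exp (A * ((c + 1) * b powr c + b * (2 + b) + b powr (c + 1)))"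
  have "((\<lambda>r::real. A * r powr (c - 1)) \<longlongrightarrow> 0) at_top"
    using assms by real_asymp
  then have "eventually (\<lambda>r. A * r powr (c - 1) < x / 2) at_top"
    using assms by (intro order_tendstoD(2)) auto
  then obtain W where W: "\<And>r. r \<ge> W \<Longrightarrow> A * r powr (c - 1) < x / 2"
    by (auto simp: eventually_at_top_linorder)
  show thesis
  proof
    \<comment> \<open>The 1 is required by \<open>norm_avg_transform_le\<close>;
      \<open>W + b\<close> ensures \<open>|b + u| \<ge> W\<close>.\<close>
    fix u assume u: "Re u \<le> 0" "0 \<le> Im u" "max 1 (W + b) \<le> cmod u"
    have "cmod u \<le> cmod (of_real b + u) + b"
      using norm_triangle_ineq4[of "of_real b + u" "of_real b"] assms by simp
    then have *: "A * cmod (of_real b + u) powr (c - 1) \<le> x / 2"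
      using u(3) by (intro less_imp_le[OF W]) simp
    have "A * max 0 (- (Re u + b) * cmod (of_real b + u) powr (c - 1)) \<le> - (x / 2) * Re u"
    proof (cases "Re u + b \<ge> 0")
      case True
      then have "- (Re u + b) * cmod (of_real b + u) powr (c - 1) \<le> 0"
        by (intro mult_nonpos_nonneg) auto
      then show ?thesis using assms u by (simp add: max_absorb1 mult_nonneg_nonpos)
    next
      case False
      then have "- (Re u + b) * (A * cmod (of_real b + u) powr (c - 1)) \<le> - (Re u + b) * (x / 2)"
        using * by (intro mult_left_mono) auto
      also have "\<dots> \<le> - (x / 2) * Re u" using assms by (simp add: algebra_simps)
      finally show ?thesis using False assms u
        by (auto simp: max_def algebra_simps mult_nonneg_nonpos)
    qed
    then have "cmod (avg_transform A b c u) \<le> ?K * exp (- (x / 2) * Re u)"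
      using norm_avg_transform_le[of u c b A] assms u
      by (auto elim!: order_trans)
    then have "cmod (exp (of_real x * u) * avg_transform A b c u) \<le> exp (x * Re u) * (?K * exp (- (x / 2) * Re u))"
      unfolding norm_mult by (intro mult_mono) auto
    also have "\<dots> = ?K * (exp (x * Re u) * exp (- (x / 2) * Re u))" by simp
    also have "exp (x * Re u) * exp (- (x / 2) * Re u) = exp (- (x / 2) * \<bar>Re u\<bar>)"
      using u by (simp add: exp_add[symmetric] field_simps)
    finally show "cmod (exp (of_real x * u) * avg_transform A b c u) \<le> ?K * exp (- (x / 2) * \<bar>Re u\<bar>)" .
  qed
qed

text \<open>Two nested removable singularities at 0: the difference quotient in the exponent, then
  the quotient \<open>H\<close> itself. With both filled in, contours may start at 0.\<close>

lemma avg_transform_quotient_extension: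
  fixes A b c y :: real
  assumes "0 < c" "0 < b"
  obtains H :: "complex \<Rightarrow> complex" where "\<And>u :: complex. u \<noteq> 0 \<Longrightarrow> H u = (exp (of_real y * u) * avg_transform A b c u - 1) / u"
    and "continuous_on {u :: complex. 0 \<le> Im u} H"
    and "\<And>u :: complex. 0 < Im u \<Longrightarrow> H field_differentiable at u"
proof -
  define q where "q u = (of_real b + u) powr of_real (c + 1)" for u :: complex
  have q_deriv: "(q has_field_derivative of_real (c + 1) * (of_real b + u) powr of_real c) (at u)"
    if "of_real b + u \<notin> \<real>\<^sub>\<le>\<^sub>0" for u :: complex
  proof -
    have "(q has_field_derivative of_real (c + 1) * (of_real b + u) powr (of_real (c + 1) - 1) * 1) (at u)"
      unfolding q_def using that by (auto intro!: derivative_eq_intros)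
    then show ?thesis by simp
  qed
  have ball: "of_real b + u \<notin> \<real>\<^sub>\<le>\<^sub>0" if "u \<in> ball 0 b" for u :: complex
    using that abs_Re_le_cmod[of u] by (auto simp: complex_nonpos_Reals_iff)
  have q_hol: "q holomorphic_on ball 0 b"
    unfolding holomorphic_on_open[OF open_ball] using q_deriv[OF ball] by blast
  have q0: "q 0 = of_real (b powr (c + 1))" unfolding q_def using powr_of_real[of b "c + 1"] assms by simp
  have dq0: "deriv q 0 = of_real ((c + 1) * b powr c)"
  proof -
    have "of_real b + 0 \<notin> (\<real>\<^sub>\<le>\<^sub>0 :: complex set)" using assms by simp
    from DERIV_imp_deriv[OF q_deriv[OF this]] show ?thesis
      using powr_of_real[of b c] assms by simp
  qed
  define g where "g u = (if u = 0 then deriv q 0 else (q u - q 0) / (u - 0))" for u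
  have g_hol: "g holomorphic_on ball 0 b"
    unfolding g_def by (rule pole_lemma_open[OF q_hol]) simp
  define G where "G u = exp (of_real y * u) * exp (of_real A * (of_real ((c + 1) * b powr c) - g u))" for u
  have G_hol: "G holomorphic_on ball 0 b"
    unfolding G_def by (intro holomorphic_intros g_hol)
  \<comment> \<open>The constant \<open>(c + 1) * b powr c\<close> of \<open>avg_transform\<close>
    is exactly \<open>deriv q 0\<close>, so the exponent vanishes at 0.\<close>
  have G0: "G 0 = 1" unfolding G_def g_def dq0 by simp
  have G: "G u = exp (of_real y * u) * avg_transform A b c u" if "u \<noteq> 0" for u
    using that unfolding G_def g_def q0 avg_transform_def by (simp add: q_def)
  define H where "H u = (if u = 0 then deriv G 0 else (G u - G 0) / (u - 0))" for u
  have H_hol: "H holomorphic_on ball 0 b"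
    unfolding H_def by (rule pole_lemma_open[OF G_hol]) simp
  have H: "H u = (exp (of_real y * u) * avg_transform A b c u - 1) / u" if "u \<noteq> 0" for u
    using that unfolding H_def G0 by (simp add: G)
  have at_q: "avg_transform A b c = (\<lambda>u. exp (of_real A * (of_real ((c + 1) * b powr c)
      - (q u - of_real (b powr (c + 1))) / u)))"
    by (rule ext) (simp only: avg_transform_def q_def)
  have q_cont: "continuous_on {u. 0 \<le> Im u} q"
    unfolding q_def
    by (rule continuous_on_compose2[OF continuous_on_powr_upper[of "c + 1"]])
       (use assms in \<open>auto intro!: continuous_on_add continuous_on_const continuous_on_id\<close>)
  have q_cont': "continuous_on ({u. 0 \<le> Im u} - {0}) q"
    by (rule continuous_on_subset[OF q_cont]) auto
  have quot_cont: "continuous_on ({u. 0 \<le> Im u} - {0}) (\<lambda>u. f u / u)"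
    if "continuous_on ({u. 0 \<le> Im u} - {0}) f" for f :: "complex \<Rightarrow> complex"
    by (rule continuous_on_divide[OF that continuous_on_id]) blast
  have at_cont: "continuous_on ({u. 0 \<le> Im u} - {0}) (avg_transform A b c)"
    unfolding at_q
    by (rule continuous_on_exp continuous_on_mult continuous_on_diff continuous_on_const quot_cont q_cont')+
  have exp_cont: "continuous_on ({u. 0 \<le> Im u} - {0}) (\<lambda>u. exp (of_real y * u))"
    by (rule continuous_on_exp continuous_on_mult continuous_on_const continuous_on_id)+
  have cont1: "continuous_on ({u. 0 \<le> Im u} - {0}) (\<lambda>u. (exp (of_real y * u) * avg_transform A b c u - 1) / u)"
    by (rule quot_cont[OF continuous_on_diff[OF continuous_on_mult[OF exp_cont at_cont] continuous_on_const]])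
  have cont2: "continuous_on ({u. 0 \<le> Im u} - {0}) H"
    by (rule continuous_on_eq[OF cont1]) (simp add: H)
  have cont3: "continuous_on ({u. 0 \<le> Im u} \<inter> ball 0 b) H"
    by (rule continuous_on_subset[OF holomorphic_on_imp_continuous_on[OF H_hol]]) blast
  \<comment> \<open>The ball of radius \<open>b\<close> stays off the cut, where \<open>H\<close> is
    holomorphic. Both pieces are relatively open, so continuity can be glued.\<close>
  have U: "{u. 0 \<le> Im u} = ({u. 0 \<le> Im u} - {0}) \<union> ({u. 0 \<le> Im u} \<inter> ball 0 b)"
    using assms by auto
  have cont: "continuous_on {u. 0 \<le> Im u} H"
    by (subst U, rule continuous_on_Un_local_open)
       (fold U, simp_all only: cont2 cont3 openin_delete openin_subtopology_self openin_open_Int open_ball)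
  have diff: "H field_differentiable at u" if "0 < Im u" for u
  proof -
    have "q field_differentiable at v" if "0 < Im v" for v
      using q_deriv[of v] that by (auto simp: field_differentiable_def complex_nonpos_Reals_iff)
    then have "q holomorphic_on {u. 0 < Im u}"
      by (auto simp: holomorphic_on_def intro: field_differentiable_at_within)
    then have "(\<lambda>u. (exp (of_real y * u) * avg_transform A b c u - 1) / u) holomorphic_on {u. 0 < Im u}"
      unfolding at_q by (intro holomorphic_intros) auto
    then have "H holomorphic_on {u. 0 < Im u}"
      by (rule holomorphic_transform) (subst H; auto)
    then show ?thesis
      using that holomorphic_on_imp_differentiable_at[OF _ open_halfspace_Im_gt] by blast
  qed
  show thesis using H cont diff by (rule that)
qed

section \<open>Values on the real axis\<close>

lemma Im_avg_transform_real:
  assumes "- b < s" "0 < b"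
  shows "Im (exp (of_real y * of_real s) * avg_transform A b c (of_real s)) = 0"
proof -
  have "(of_real b + of_real s :: complex) powr of_real (c + 1) = of_real ((b + s) powr (c + 1))"
    using assms by (subst powr_of_real[symmetric]) auto
  then have "exp (of_real y * of_real s) * avg_transform A b c (of_real s) =
      complex_of_real (exp (y * s) * exp (A * ((c + 1) * b powr c - ((b + s) powr (c + 1) - b powr (c + 1)) / s)))"
    unfolding avg_transform_def by (simp flip: exp_of_real)
  then show ?thesis by simp
qed

text \<open>The integrand of the theorem in terms of \<open>A = a t \<Gamma>(-c-1)\<close>. It
  vanishes at \<open>y = 1\<close> because of the factor \<open>1 - y\<close> in the sine, so this
  endpoint may be added or dropped.\<close>

definition cut_integrand :: "real \<Rightarrow> real \<Rightarrow> real \<Rightarrow> real \<Rightarrow> real \<Rightarrow> real" where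
  "cut_integrand A b c x y =
     1 / y * exp (- A * b powr c * (y + cos (pi * c) * (1 - y) * (1 / y - 1) powr c) - b * x / y) *
     sin (A * b powr c * sin (pi * c) * (1 - y) * (1 / y - 1) powr c)"

text \<open>At \<open>u = - b / y\<close> one has \<open>b + u = - \<rho>\<close> with
  \<open>\<rho> = b * (1 / y - 1)\<close>, and the principal power is
  \<open>- \<rho> powr (c + 1) * cis (pi * c)\<close>. Its cosine part goes into the exponential and
  its sine part into the sine. The factor \<open>1 / y\<close> comes from
  \<open>du / u = - dy / y\<close>.\<close>

lemma Im_avg_transform_cut:
  assumes "0 < y" "y < 1" "0 < b"
  shows "1 / y * Im (exp (of_real x * of_real (- (b / y))) * avg_transform A b c (of_real (- (b / y))))
     = - exp (A * (c + 1) * b powr c) * cut_integrand A b c x y"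
proof -
  define \<rho> where "\<rho> = b * (1 / y - 1)"
  define E where "E = (1 - y) * (1 / y - 1) powr c"
  have y: "1 / y - 1 > 0" using assms by simp
  then have \<rho>: "\<rho> > 0" unfolding \<rho>_def using assms by simp
  have "\<rho> powr (c + 1) = b powr (c + 1) * ((1 / y - 1) powr c * (1 / y - 1))"
    unfolding \<rho>_def using y assms by (simp add: powr_mult powr_add)
  also have "(1 / y - 1) powr c * (1 / y - 1) = E / y"
    unfolding E_def using assms by (simp add: field_simps)
  finally have \<rho>c: "\<rho> powr (c + 1) * (y / b) = b powr c * E"
    using assms by (simp add: powr_add)
  have "of_real b + of_real (- (b / y)) = complex_of_real (- \<rho>)"
    unfolding \<rho>_def by (simp add: algebra_simps)
  moreover have "complex_of_real (- \<rho>) powr of_real (c + 1) = - of_real (\<rho> powr (c + 1)) * cis (pi * c)"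
  proof -
    have "Ln (complex_of_real (- \<rho>)) = of_real (ln \<rho>) + \<i> * pi"
      using \<rho> by (simp add: Ln_minus Ln_of_real)
    then have "complex_of_real (- \<rho>) powr of_real (c + 1)
        = exp (of_real ((c + 1) * ln \<rho>)) * exp (\<i> * of_real (pi * c) + \<i> * pi)"
      using \<rho> by (simp add: powr_def exp_add[symmetric] algebra_simps)
    also have "exp (\<i> * of_real (pi * c) + \<i> * pi) = - cis (pi * c)"
      by (simp add: exp_add cis_conv_exp)
    also have "exp (of_real ((c + 1) * ln \<rho>)) = complex_of_real (\<rho> powr (c + 1))"
      using \<rho> by (simp only: exp_of_real powr_def) simp
    finally show ?thesis by simp
  qed
  ultimately have pw: "(of_real b + of_real (- (b / y))) powr of_real (c + 1) = - of_real (\<rho> powr (c + 1)) * cis (pi * c)"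
    by (simp only:)
  have "((of_real b + of_real (- (b / y))) powr of_real (c + 1) - of_real (b powr (c + 1))) / of_real (- (b / y))
      = of_real (\<rho> powr (c + 1) * (y / b)) * cis (pi * c) + complex_of_real (b powr (c + 1) * (y / b))"
    unfolding pw using assms by (simp add: field_simps)
  also have "b powr (c + 1) * (y / b) = b powr c * y" using assms by (simp add: powr_add)
  also have "of_real (\<rho> powr (c + 1) * (y / b)) * cis (pi * c) + complex_of_real (b powr c * y)
     = Complex (b powr c * (y + cos (pi * c) * E)) (b powr c * sin (pi * c) * E)"
    unfolding \<rho>c by (simp add: complex_eq_iff algebra_simps)
  finally have quot: "((of_real b + of_real (- (b / y))) powr of_real (c + 1) - of_real (b powr (c + 1))) / of_real (- (b / y))
     = Complex (b powr c * (y + cos (pi * c) * E)) (b powr c * sin (pi * c) * E)" .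
  have "avg_transform A b c (of_real (- (b / y))) =
     exp (Complex (A * ((c + 1) * b powr c) - A * (b powr c * (y + cos (pi * c) * E))) (- (A * (b powr c * sin (pi * c) * E))))"
    unfolding avg_transform_def quot by (intro arg_cong[where f = exp]) (simp add: complex_eq_iff algebra_simps)
  moreover have "exp (of_real x * of_real (- (b / y))) = complex_of_real (exp (- (b * x / y)))"
    by (simp add: exp_of_real[symmetric] mult_ac)
  ultimately have "Im (exp (of_real x * of_real (- (b / y))) * avg_transform A b c (of_real (- (b / y))))
    = - (exp (- (b * x / y)) * exp (A * ((c + 1) * b powr c) - A * (b powr c * (y + cos (pi * c) * E)))
       * sin (A * (b powr c * sin (pi * c) * E)))"
    by (simp add: Im_exp)
  also have "exp (- (b * x / y)) * exp (A * ((c + 1) * b powr c) - A * (b powr c * (y + cos (pi * c) * E)))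
     = exp (A * (c + 1) * b powr c) * exp (- A * b powr c * (y + cos (pi * c) * E) - b * x / y)"
    by (simp add: exp_add[symmetric] algebra_simps)
  finally show ?thesis
    unfolding cut_integrand_def E_def by (simp add: mult_ac)
qed

section \<open>The characteristic function of the running average\<close>

text \<open>Paths may jump, so only right continuity is available. Sampling at right endpoints fits
  it: the sample point belonging to \<open>s\<close> tends to \<open>s\<close> from the right, and
  bounded step functions allow dominated convergence. The lemma serves both the paths and the
  Laplace exponent.\<close>

lemma riemann_sum_right_continuous:
  fixes f :: "real \<Rightarrow> 'b::{banach, second_countable_topology}"
  assumes t: "t > 0"
    and rc: "\<And>s. 0 < s \<Longrightarrow> s \<le> t \<Longrightarrow> (f \<longlongrightarrow> f s) (at_right s)"
    and bound: "\<And>s. 0 \<le> s \<Longrightarrow> s \<le> t \<Longrightarrow> norm (f s) \<le> B"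
  shows "(\<lambda>n. (t / real n) *\<^sub>R (\<Sum>k<n. f (real (Suc k) * t / real n))) \<longlonglongrightarrow> (LBINT s:{0..t}. f s)"
proof -
  \<comment> \<open>\<open>g n\<close> is the step function of the Riemann sum, and
    \<open>p n s\<close> is \<open>s\<close> rounded up to the grid, so that
    \<open>g n s = f (p n s)\<close> on \<open>{0<..t}\<close>.\<close>
  define g where "g n s = (\<Sum>k<n. indicator {real k * t / n<..real (Suc k) * t / n} s *\<^sub>R f (real (Suc k) * t / n))"
    for n s
  define p where "p n s = of_int \<lceil>real n * s / t\<rceil> * t / n" for n :: nat and s
  have g_eq: "g n s = f (p n s)" if s: "0 < s" "s \<le> t" and n: "n > 0" for n s
  proof -
    define m where "m = nat (\<lceil>real n * s / t\<rceil> - 1)"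
    have "\<lceil>real n * s / t\<rceil> > 0" using s t n by simp
    then have m: "\<lceil>real n * s / t\<rceil> = int m + 1" unfolding m_def by simp
    have "real n * s / t \<le> real n" using s t n by (simp add: field_simps)
    then have "\<lceil>real n * s / t\<rceil> \<le> int n" by (simp add: ceiling_le_iff)
    then have mn: "m < n" using m by simp
    have "indicator {real k * t / n<..real (Suc k) * t / n} s = (if k = m then 1 else 0 :: real)" for k
    proof -
      have "s \<in> {real k * t / n<..real (Suc k) * t / n} \<longleftrightarrow> \<lceil>real n * s / t\<rceil> = int k + 1"
        using t n by (auto simp: ceiling_eq_iff field_simps)
      then show ?thesis using m by (auto simp: indicator_def)
    qed
    then have "g n s = f (real (Suc m) * t / n)"
      unfolding g_def using mn by (simp add: if_distrib[of "\<lambda>r. r *\<^sub>R _"] cong: if_cong)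
    also have "real (Suc m) * t / n = p n s" unfolding p_def m by simp
    finally show ?thesis .
  qed
  have p_ge: "s \<le> p n s" and p_le: "p n s \<le> s + t / n" if "n > 0" for n s
  proof -
    have "real n * s / t \<le> of_int \<lceil>real n * s / t\<rceil>" "of_int \<lceil>real n * s / t\<rceil> \<le> real n * s / t + 1"
      by linarith+
    then have "real n * s / t * (t / n) \<le> of_int \<lceil>real n * s / t\<rceil> * (t / n)"
        "of_int \<lceil>real n * s / t\<rceil> * (t / n) \<le> (real n * s / t + 1) * (t / n)"
      using t by (intro mult_right_mono; simp)+
    then have "s \<le> of_int \<lceil>real n * s / t\<rceil> * (t / n)"
        "of_int \<lceil>real n * s / t\<rceil> * (t / n) \<le> s + t / n"
      unfolding distrib_right using t that by simp_all
    then show "s \<le> p n s" "p n s \<le> s + t / n"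
      unfolding p_def by simp_all
  qed
  have p_t: "p n s \<le> t" if "s \<le> t" "n > 0" for n s
  proof -
    have "real n * s / t \<le> real n" using that t by (simp add: field_simps)
    then have "\<lceil>real n * s / t\<rceil> \<le> int n" by (simp add: ceiling_le_iff)
    then have "of_int \<lceil>real n * s / t\<rceil> \<le> real n" by linarith
    then show ?thesis unfolding p_def using that t by (simp add: field_simps)
  qed
  have g_out: "g n s = 0" if "s \<notin> {0<..t}" for n s
  proof -
    have "s \<notin> {real k * t / n<..real (Suc k) * t / n}" if "k < n" for k
    proof
      assume s: "s \<in> {real k * t / n<..real (Suc k) * t / n}"
      have "0 \<le> real k * t / n" using t by simp
      moreover have "real (Suc k) * t \<le> real n * t"
        using \<open>k < n\<close> t by (intro mult_right_mono) auto
      then have "real (Suc k) * t / n \<le> t"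
        using \<open>k < n\<close> by (simp add: pos_divide_le_eq mult.commute)
      ultimately show False using s \<open>s \<notin> {0<..t}\<close> by auto
    qed
    then show ?thesis unfolding g_def by (intro sum.neutral) auto
  qed
  have lim: "(\<lambda>n. g n s) \<longlonglongrightarrow> indicator {0<..t} s *\<^sub>R f s" for s
  proof (cases "s \<in> {0<..t}")
    case True
    have f_cont: "continuous (at s within {s..}) f"
      using rc[of s] True by (simp add: continuous_within at_within_Ici_at_right)
    \<comment> \<open>The shift to \<open>Suc n\<close> excludes \<open>n = 0\<close>, where
      division by zero makes \<open>p\<close> meaningless.\<close>
    have p_lim: "(\<lambda>n. p (Suc n) s) \<longlonglongrightarrow> s"
    proof (rule tendsto_sandwich[where f = "\<lambda>_. s" and h = "\<lambda>n. s + t / real (Suc n)"])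
      show "(\<lambda>n. s + t / real (Suc n)) \<longlonglongrightarrow> s"
        using tendsto_add[OF tendsto_const[of s] tendsto_mult_right[OF LIMSEQ_inverse_real_of_nat, of t]]
        by (simp add: divide_inverse mult.commute)
      show "\<forall>\<^sub>F n in sequentially. p (Suc n) s \<le> s + t / real (Suc n)"
        by (intro always_eventually allI p_le) simp
    qed (use p_ge in auto)
    have "(\<lambda>n. f (p (Suc n) s)) \<longlonglongrightarrow> f s"
      using p_ge by (intro continuous_within_tendsto_compose'[OF f_cont _ p_lim]) auto
    then have "(\<lambda>n. g (Suc n) s) \<longlonglongrightarrow> f s" using g_eq True by simp
    then show ?thesis using True by (simp add: filterlim_sequentially_Suc[of "\<lambda>n. g n s"])
  qed (simp add: g_out)
  have gm[measurable]: "g n \<in> borel_measurable lborel" for n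
    unfolding g_def by measurable
  \<comment> \<open>\<open>f\<close> inherits measurability as the pointwise limit of step
    functions.\<close>
  have fm[measurable]: "(\<lambda>s. indicator {0<..t} s *\<^sub>R f s) \<in> borel_measurable lborel"
    by (rule borel_measurable_LIMSEQ_metric[OF gm lim])
  have "(\<lambda>n. integral\<^sup>L lborel (g n)) \<longlonglongrightarrow> (LINT s|lborel. indicator {0<..t} s *\<^sub>R f s)"
  proof (rule integral_dominated_convergence)
    show "integrable lborel (\<lambda>s. indicator {0..t} s * B)"
      using t by (intro integrable_mult_left) (simp add: integrable_indicator_iff emeasure_lborel_Icc_eq)
    show "AE s in lborel. norm (g n s) \<le> indicator {0..t} s * B" for n
    proof (rule AE_I2)
      fix s
      show "norm (g n s) \<le> indicator {0..t} s * B"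
      proof (cases "s \<in> {0<..t} \<and> n > 0")
        case True
        then show ?thesis using g_eq[of s n] bound[of "p n s"] p_ge[of n s] p_t[of s n]
          by (auto simp: indicator_def)
      next
        case False
        then have "g n s = 0" using g_out by (auto simp: g_def)
        then show ?thesis using bound[of 0] t by (auto simp: indicator_def intro: order_trans[OF norm_ge_zero])
      qed
    qed
  qed (use lim in auto)
  moreover have "integral\<^sup>L lborel (g n) = (t / real n) *\<^sub>R (\<Sum>k<n. f (real (Suc k) * t / real n))" for n
  proof -
    have "integral\<^sup>L lborel (g n) = (\<Sum>k<n. (real (Suc k) * t / n - real k * t / n) *\<^sub>R f (real (Suc k) * t / n))"
      unfolding g_def using t
      by (subst Bochner_Integration.integral_sum)
         (auto intro!: sum.cong integrable_scaleR_left simp: divide_right_mono mult_right_mono)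
    also have "\<dots> = (\<Sum>k<n. (t / n) *\<^sub>R f (real (Suc k) * t / n))"
      by (intro sum.cong refl) (simp add: algebra_simps flip: diff_divide_distrib)
    finally show ?thesis by (simp add: scaleR_sum_right)
  qed
  moreover have "(LINT s|lborel. indicator {0<..t} s *\<^sub>R f s) = (LBINT s:{0..t}. f s)"
  proof -
    have *: "indicator {0..t} s *\<^sub>R f s = indicator {0<..t} s *\<^sub>R f s + indicator {0} s *\<^sub>R f 0" for s
      using t by (auto simp: indicator_def)
    show ?thesis unfolding set_lebesgue_integral_def
    proof (rule integral_cong_AE)
      show "(\<lambda>s. indicator {0..t} s *\<^sub>R f s) \<in> borel_measurable lborel" unfolding * by measurable
      show "AE s in lborel. indicator {0<..t} s *\<^sub>R f s = indicator {0..t} s *\<^sub>R f s"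
        using AE_lborel_singleton[of 0] by eventually_elim (auto simp: indicator_def)
    qed (rule fm)
  qed
  ultimately show ?thesis by simp
qed

text \<open>Abel summation: the increment from \<open>j\<close> to \<open>Suc j\<close> enters the
  \<open>n - j\<close> later values. This rewrites a Riemann sum of a path in independent
  increments.\<close>

lemma sum_by_parts_increments:
  fixes f :: "nat \<Rightarrow> real"
  shows "(\<Sum>k<n. f (Suc k)) = real n * f 0 + (\<Sum>j<n. real (n - j) * (f (Suc j) - f j))"
proof (induction n)
  case (Suc n)
  have "(\<Sum>j<Suc n. real (Suc n - j) * (f (Suc j) - f j))
      = (\<Sum>j<Suc n. real (n - j) * (f (Suc j) - f j) + (f (Suc j) - f j))"
    by (intro sum.cong refl) (auto simp: Suc_diff_le algebra_simps)
  also have "\<dots> = (\<Sum>j<n. real (n - j) * (f (Suc j) - f j)) + (f (Suc n) - f 0)"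
    unfolding sum.distrib by (simp only: sum_lessThan_telescope) simp
  finally show ?case using Suc by (simp add: algebra_simps)
qed simp

section \<open>Riemann sums of the sample paths\<close>

context subordinator
begin

lemma running_average_limit:
  assumes "t > 0" "\<omega> \<in> space M"
  shows "(\<lambda>n. (\<Sum>k<n. X (real (Suc k) * t / real n) \<omega>) / real n) \<longlonglongrightarrow> running_average X t \<omega>"
proof -
  have mono: "X r \<omega> \<le> X s \<omega>" if "0 \<le> r" "r \<le> s" for r s
    using nondecreasing_paths[OF assms(2)] that by (auto simp: mono_on_def)
  have "(\<lambda>n. (t / real n) *\<^sub>R (\<Sum>k<n. X (real (Suc k) * t / real n) \<omega>)) \<longlonglongrightarrow> (LBINT s:{0..t}. X s \<omega>)"
  proof (rule riemann_sum_right_continuous[where B = "\<bar>X 0 \<omega>\<bar> + \<bar>X t \<omega>\<bar>"])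
    show "((\<lambda>s. X s \<omega>) \<longlongrightarrow> X s \<omega>) (at_right s)" if "0 < s" for s
      using cadlag_paths[OF assms(2)] that unfolding cadlag_def by auto
    show "norm (X s \<omega>) \<le> \<bar>X 0 \<omega>\<bar> + \<bar>X t \<omega>\<bar>" if "0 \<le> s" "s \<le> t" for s
      using mono[of 0 s] mono[of s t] that by simp
  qed (rule assms)
  from tendsto_mult_left[OF this, of "1 / t"] show ?thesis
    unfolding running_average_def using assms(1) by simp
qed

text \<open>Obtained from the pointwise limit of Riemann sums, which avoids joint measurability of
  \<open>X\<close> in time and sample point.\<close>

lemma running_average_measurable:
  assumes "t > 0"
  shows "running_average X t \<in> borel_measurable M"
proof (rule borel_measurable_LIMSEQ_metric)
  show "(\<lambda>\<omega>. (\<Sum>k<n. X (real (Suc k) * t / real n) \<omega>) / real n) \<in> borel_measurable M" for n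
    using assms by (intro borel_measurable_divide borel_measurable_sum random_variable_X) auto
qed (rule running_average_limit[OF assms])

end

context tempered_stable_subordinator
begin

text \<open>Stationarity and \<open>X 0 = 0\<close> almost surely reduce the increment to
  \<open>X h\<close>; then the Laplace transform is taken at \<open>u = - \<i> * \<theta>\<close>,
  which has real part \<open>0 > - b\<close>.\<close>

lemma char_increment:
  assumes "0 \<le> s" "0 \<le> h"
  shows "char (distr M borel (\<lambda>\<omega>. X (s + h) \<omega> - X s \<omega>)) \<theta> =
     exp (of_real (a * h * Gamma (- c)) * ((of_real b - \<i> * \<theta>) powr of_real c - of_real b powr of_real c))"
proof -
  have [measurable]: "X h \<in> borel_measurable M" "X 0 \<in> borel_measurable M"
    using assms by (auto intro: random_variable_X)
  have "char (distr M borel (\<lambda>\<omega>. X (s + h) \<omega> - X s \<omega>)) \<theta> = (LINT \<omega>|M. iexp (\<theta> * (X h \<omega> - X 0 \<omega>)))"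
    unfolding stationary_increments[OF assms] char_def by (subst integral_distr) auto
  also have "\<dots> = (LINT \<omega>|M. exp (- (- \<i> * \<theta>) * of_real (X h \<omega>)))"
    by (rule integral_cong_AE) (use X_start in \<open>auto elim!: eventually_mono simp: mult.assoc\<close>)
  also have "\<dots> = exp (of_real (a * h * Gamma (- c)) * ((of_real b - \<i> * \<theta>) powr of_real c - of_real b powr of_real c))"
    using laplace_transform[of h "- \<i> * \<theta>"] assms b_pos by simp
  finally show ?thesis .
qed

text \<open>By Abel summation the Riemann sum is a weighted sum of independent increments, so the
  characteristic function is a product and the exponents add up. The right-hand side is shaped as a
  right-endpoint Riemann sum over \<open>[0, t]\<close>, ready for
  \<open>riemann_sum_right_continuous\<close>.\<close>

lemma char_riemann_sum:
  assumes "t > 0"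
  shows "char (distr M borel (\<lambda>\<omega>. (\<Sum>k<n. X (real (Suc k) * t / real n) \<omega>) / real n)) \<theta> =
     exp (of_real (a * Gamma (- c)) * ((t / real n) *\<^sub>R
        (\<Sum>k<n. (of_real b - \<i> * of_real (\<theta> * (real (Suc k) * t / real n) / t)) powr of_real c - of_real b powr of_real c)))"
proof -
  define \<tau> where "\<tau> k = real k * t / real n" for k
  define \<psi> where "\<psi> r = (of_real b - \<i> * of_real r) powr of_real c - of_real b powr of_real c" for r :: real
  define Y where "Y j \<omega> = real (n - j) / real n * (X (\<tau> (Suc j)) \<omega> - X (\<tau> j) \<omega>)" for j \<omega>
  have \<tau>0: "\<tau> k \<ge> 0" for k unfolding \<tau>_def using assms by simp
  have [measurable]: "X (\<tau> k) \<in> borel_measurable M" for k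
    by (rule random_variable_X[OF \<tau>0])
  \<comment> \<open>The quotient \<open>real n / real n\<close> is left uncancelled so that the
    identity also holds for \<open>n = 0\<close>.\<close>
  have "(\<Sum>k<n. X (\<tau> (Suc k)) \<omega>) / real n = X 0 \<omega> * real n / real n + (\<Sum>j<n. Y j \<omega>)" for \<omega>
    using sum_by_parts_increments[of "\<lambda>k. X (\<tau> k) \<omega>" n]
    by (simp add: Y_def add_divide_distrib sum_divide_distrib \<tau>_def mult.commute)
  then have AE: "AE \<omega> in M. (\<Sum>k<n. X (\<tau> (Suc k)) \<omega>) / real n = (\<Sum>j<n. Y j \<omega>)"
    using X_start by (auto elim!: eventually_mono)
  have [measurable]: "Y j \<in> borel_measurable M" for j unfolding Y_def by measurable
  have "char (distr M borel (\<lambda>\<omega>. (\<Sum>k<n. X (\<tau> (Suc k)) \<omega>) / real n)) \<theta>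
      = char (distr M borel (\<lambda>\<omega>. \<Sum>j<n. Y j \<omega>)) \<theta>"
    using AE by (intro arg_cong2[where f = char] distr_cong_AE) auto
  also have "\<dots> = (\<Prod>j<n. char (distr M borel (Y j)) \<theta>)"
  proof (rule char_distr_sum)
    have "indep_vars (\<lambda>_. borel) (\<lambda>i \<omega>. X (\<tau> (Suc i)) \<omega> - X (\<tau> i) \<omega>) {..<n}"
      using assms \<tau>0 by (intro independent_increments) (auto simp: \<tau>_def intro!: divide_strict_right_mono mult_strict_right_mono)
    then show "indep_vars (\<lambda>_. borel) Y {..<n}"
      unfolding Y_def by (rule indep_vars_compose2[where Y = "\<lambda>j x. real (n - j) / real n * x"]) auto
  qed
  also have "\<dots> = (\<Prod>j<n. exp (of_real (a * (t / n) * Gamma (- c)) * \<psi> (\<theta> * (real (n - j) / real n))))"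
  proof (rule prod.cong[OF refl])
    fix j assume "j \<in> {..<n}"
    have "char (distr M borel (Y j)) \<theta>
        = char (distr M borel (\<lambda>\<omega>. X (\<tau> (Suc j)) \<omega> - X (\<tau> j) \<omega>)) (\<theta> * (real (n - j) / real n))"
      unfolding char_def Y_def by (subst (1 2) integral_distr) (auto simp: mult.assoc)
    moreover have "\<tau> (Suc j) = \<tau> j + t / n" unfolding \<tau>_def by (simp add: field_simps add_divide_distrib)
    ultimately show "char (distr M borel (Y j)) \<theta>
        = exp (of_real (a * (t / n) * Gamma (- c)) * \<psi> (\<theta> * (real (n - j) / real n)))"
      using char_increment[OF \<tau>0, of "t / n" j] assms by (simp add: \<psi>_def)
  qed
  also have "\<dots> = exp (of_real (a * (t / n) * Gamma (- c)) * (\<Sum>j<n. \<psi> (\<theta> * (real (n - j) / real n))))"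
    by (simp add: exp_sum sum_distrib_left)
  \<comment> \<open>Reversing the order of summation turns the decreasing weights
    \<open>(n - j) / n\<close> into increasing grid points.\<close>
  also have "(\<Sum>j<n. \<psi> (\<theta> * (real (n - j) / real n))) = (\<Sum>j<n. \<psi> (\<theta> * (real (Suc j) * t / real n) / t))"
  proof -
    have "(\<Sum>j<n. \<psi> (\<theta> * (real (n - j) / real n))) = (\<Sum>j<n. \<psi> (\<theta> * (real (Suc (n - Suc j)) / real n)))"
      by (intro sum.cong refl) (simp add: Suc_diff_Suc)
    also have "\<dots> = (\<Sum>j<n. \<psi> (\<theta> * (real (Suc j) / real n)))"
      by (rule sum.nat_diff_reindex)
    finally show ?thesis using assms by simp
  qed
  finally show ?thesis
    unfolding \<tau>_def \<psi>_def by (simp add: scaleR_conv_of_real mult_ac)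
qed

text \<open>The Riemann sums converge pathwise and \<open>iexp\<close> has modulus 1, so their
  characteristic functions converge; the exponents converge to the integral of the Laplace
  exponent.\<close>

lemma char_running_average:
  assumes "t > 0" "\<theta> \<noteq> 0"
  shows "char (distr M borel (running_average X t)) \<theta> =
     exp (of_real (a * t * Gamma (- c)) *
       (((of_real b - \<i> * \<theta>) powr of_real (c + 1) - of_real b powr of_real (c + 1)) / (of_real (c + 1) * (- \<i> * \<theta>))
         - of_real b powr of_real c))"
proof -
  define \<psi> where "\<psi> s = (of_real b - \<i> * of_real (\<theta> * s / t)) powr of_real c - of_real b powr of_real c" for s :: real
  let ?S = "\<lambda>n \<omega>. (\<Sum>k<n. X (real (Suc k) * t / real n) \<omega>) / real n"
  have S[measurable]: "?S n \<in> borel_measurable M" for n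
    using assms by (intro borel_measurable_divide borel_measurable_sum random_variable_X) auto
  have A[measurable]: "running_average X t \<in> borel_measurable M"
    by (rule running_average_measurable[OF assms(1)])
  have char_integrand: "(\<lambda>x. iexp (\<theta> * x)) \<in> borel_measurable borel"
    by measurable
  have "(\<lambda>n. LINT \<omega>|M. iexp (\<theta> * ?S n \<omega>)) \<longlonglongrightarrow> (LINT \<omega>|M. iexp (\<theta> * running_average X t \<omega>))"
  proof (rule integral_dominated_convergence[where w = "\<lambda>_. 1"])
    show "(\<lambda>\<omega>. iexp (\<theta> * ?S n \<omega>)) \<in> borel_measurable M" for n
      by measurable
    show "AE \<omega> in M. (\<lambda>n. iexp (\<theta> * ?S n \<omega>)) \<longlonglongrightarrow> iexp (\<theta> * running_average X t \<omega>)"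
      by (intro AE_I2 tendsto_exp tendsto_mult tendsto_of_real tendsto_const running_average_limit assms)
  qed auto
  then have 1: "(\<lambda>n. char (distr M borel (?S n)) \<theta>) \<longlonglongrightarrow> char (distr M borel (running_average X t)) \<theta>"
    unfolding char_def integral_distr[OF S char_integrand] integral_distr[OF A char_integrand] .
  have cont: "continuous_on A \<psi>" for A
    unfolding \<psi>_def using b_pos c_pos assms(1) by (intro continuous_intros) auto
  obtain B where B: "\<And>s. s \<in> {0..t} \<Longrightarrow> norm (\<psi> s) \<le> B"
    using compact_imp_bounded[OF compact_continuous_image[OF cont compact_Icc]]
    unfolding bounded_iff by blast
  have "(\<lambda>n. (t / real n) *\<^sub>R (\<Sum>k<n. \<psi> (real (Suc k) * t / real n))) \<longlonglongrightarrow> (LBINT s:{0..t}. \<psi> s)"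
  proof (rule riemann_sum_right_continuous[where B = B])
    show "(\<psi> \<longlongrightarrow> \<psi> s) (at_right s)" for s
      using cont[of UNIV] by (meson UNIV_I continuous_on_def tendsto_within_subset top_greatest)
  qed (use assms B in auto)
  then have "(\<lambda>n. char (distr M borel (?S n)) \<theta>) \<longlonglongrightarrow> exp (of_real (a * Gamma (- c)) * (LBINT s:{0..t}. \<psi> s))"
    unfolding char_riemann_sum[OF assms(1)] \<psi>_def by (intro tendsto_intros)
  with 1 have "char (distr M borel (running_average X t)) \<theta> = exp (of_real (a * Gamma (- c)) * (LBINT s:{0..t}. \<psi> s))"
    using LIMSEQ_unique by blast
  moreover have "(LBINT s:{0..t}. \<psi> s) = t * (((of_real b - \<i> * \<theta>) powr of_real (c + 1) - of_real b powr of_real (c + 1)) / (of_real (c + 1) * (- \<i> * \<theta>))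
         - of_real b powr of_real c)"
  proof -
    \<comment> \<open>An antiderivative taken over the complex numbers, so that the rules for
      complex powers apply; at real \<open>s\<close> the base has real part \<open>b > 0\<close> and
      is off the cut.\<close>
    define F where "F z = (of_real b - \<i> * of_real (\<theta> / t) * z) powr of_real (c + 1) / (of_real (c + 1) * (- \<i> * of_real (\<theta> / t)))
         - of_real b powr of_real c * z" for z :: complex
    have nz: "of_real (c + 1) * (- \<i> * of_real (\<theta> / t)) \<noteq> (0::complex)"
      using assms c_pos by (auto simp: complex_eq_iff)
    have D: "(F has_field_derivative \<psi> s) (at (of_real s))" for s
    proof -
      have "(F has_field_derivative (of_real (c + 1) * (of_real b - \<i> * of_real (\<theta> / t) * s) powr (of_real (c + 1) - 1)
          * (- \<i> * of_real (\<theta> / t))) / (of_real (c + 1) * (- \<i> * of_real (\<theta> / t))) - of_real b powr of_real c) (at (of_real s))"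
        unfolding F_def using nz b_pos
        by (auto intro!: derivative_eq_intros simp: complex_nonpos_Reals_iff)
      also have "(of_real (c + 1) * (of_real b - \<i> * of_real (\<theta> / t) * s) powr (of_real (c + 1) - 1)
          * (- \<i> * of_real (\<theta> / t))) / (of_real (c + 1) * (- \<i> * of_real (\<theta> / t))) - of_real b powr of_real c = \<psi> s"
        using nz by (simp add: \<psi>_def mult_ac)
      finally show ?thesis .
    qed
    have "(LBINT s:{0..t}. \<psi> s) = F (of_real t) - F (of_real 0)"
      unfolding set_lebesgue_integral_def using assms cont D
      by (intro integral_FTC_atLeastAtMost[where F = "\<lambda>s. F (of_real s)"])
         (auto intro!: has_vector_derivative_real_field intro: has_field_derivative_at_within)
    also have "\<dots> = t * (((of_real b - \<i> * \<theta>) powr of_real (c + 1) - of_real b powr of_real (c + 1)) / (of_real (c + 1) * (- \<i> * \<theta>))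
         - of_real b powr of_real c)"
    proof -
      have q: "of_real (c + 1) * (- \<i> * of_real (\<theta> / t)) = of_real (c + 1) * (- \<i> * \<theta>) / of_real t"
        by simp
      have "\<i> * of_real (\<theta> / t) * of_real t = \<i> * \<theta>"
        using assms by simp
      then show ?thesis
        unfolding F_def q by (simp add: right_diff_distrib diff_divide_distrib mult_ac)
    qed
    finally show ?thesis .
  qed
  ultimately show ?thesis by (simp add: mult_ac)
qed

end

section \<open>Inversion\<close>

text \<open>Rescales the unit parameter interval to \<open>{0..T}\<close>, so that contour integrals
  can be compared with real integrals. Used for the directions \<open>1\<close>, \<open>-1\<close>
  and \<open>\<i>\<close>.\<close>

lemma has_integral_contour_ray:
  assumes "T > 0" "H contour_integrable_on (linepath 0 (d * of_real T))"
  shows "((\<lambda>s. H (d * of_real s) * d) has_integral contour_integral (linepath 0 (d * of_real T)) H) {0..T}"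
proof -
  let ?I = "contour_integral (linepath 0 (d * of_real T)) H"
  have "((\<lambda>r. H (linepath 0 (d * of_real T) r) * (d * of_real T - 0)) has_integral ?I) {0..1}"
    using has_contour_integral_integral[OF assms(2)] by (simp only: has_contour_integral_linepath)
  also have "(\<lambda>r. H (linepath 0 (d * of_real T) r) * (d * of_real T - 0)) = (\<lambda>r. H (of_real r * (d * of_real T)) * (d * of_real T))"
    by (simp add: linepath_def scaleR_conv_of_real)
  finally have "((\<lambda>r. H (of_real r * (d * of_real T)) * (d * of_real T)) has_integral ?I) {0..1}" .
  from has_integral_stretch_real[OF this, of "1 / T"] assms(1)
  have "((\<lambda>s. H (of_real (1 / T * s) * (d * of_real T)) * (d * of_real T)) has_integral T *\<^sub>R ?I) ((\<lambda>s. s / (1 / T)) ` {0..1})"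
    by simp
  also have "(\<lambda>s. s / (1 / T)) ` {0..1} = {0..T}"
    using assms(1) image_mult_atLeastAtMost[of T 0 1] by (simp add: mult.commute)
  also have "(\<lambda>s. H (of_real (1 / T * s) * (d * of_real T)) * (d * of_real T)) = (\<lambda>s. H (d * of_real s) * d * of_real T)"
    using assms(1) by (simp add: mult_ac)
  finally have "((\<lambda>s. H (d * of_real s) * d * of_real T * of_real (1 / T)) has_integral T *\<^sub>R ?I * of_real (1 / T)) {0..T}"
    by (rule has_integral_mult_left)
  then show ?thesis using assms(1) by (simp add: scaleR_conv_of_real)
qed

lemma char_minus: "char M (- s) = cnj (char M s)"
proof -
  have "char M (- s) = (CLINT x|M. cnj (iexp (s * x)))"
    unfolding char_def by (simp add: exp_cnj)
  then show ?thesis unfolding char_def by simp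
qed

text \<open>The Levy integrand is \<open>D s\<close> at \<open>- s\<close> and
  \<open>cnj (D s)\<close> at \<open>s\<close>, so its integral over \<open>[-n, n]\<close> is twice
  a real part over \<open>[0, n]\<close>. The argument \<open>- s\<close> of \<open>char\<close>
  makes this the Laplace transform at \<open>\<i> * s\<close>; \<open>D\<close> is the continuous
  version of the integrand, which is singular at 0.\<close>

lemma (in real_distribution) Levy_Inversion_half_line:
  assumes ax: "a < x" and null: "measure M {a} = 0" "measure M {x} = 0"
    and cont: "continuous_on {0..} D"
    and D: "\<And>s. s > 0 \<Longrightarrow> D s = (iexp (s * x) - iexp (s * a)) / (\<i> * s) * char M (- s)"
  shows "(\<lambda>n. Re (integral {0..real n} D) / pi) \<longlonglongrightarrow> measure M {a<..x}"
proof -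
  define f where "f t = (iexp (- (t * a)) - iexp (- (t * x))) / (\<i> * t) * char M t" for t :: real
  have flip: "(p - q) / (- w) = (q - p) / w" for p q w :: complex
    by (metis minus_diff_eq minus_divide_divide minus_minus)
  have f_neg: "f (- s) = D s" if "s > 0" for s
  proof -
    have e: "- (- s * a) = s * a" "- (- s * x) = s * x" "\<i> * of_real (- s) = - (\<i> * s)" by simp_all
    show ?thesis unfolding f_def D[OF that] e flip ..
  qed
  have f_pos: "f s = cnj (D s)" if "s > 0" for s
  proof -
    have e: "cnj (iexp y) = iexp (- y)" for y by (simp add: exp_cnj)
    have e': "cnj (\<i> * s) = - (\<i> * s)" by simp
    show ?thesis
      unfolding f_def D[OF that] complex_cnj_mult[of "_ / _"] complex_cnj_divide complex_cnj_diff e e' flip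
        char_minus complex_cnj_cnj ..
  qed
  have hk: "(f has_integral of_real (2 * Re (integral {0..real n} D))) {- real n..real n}" for n
  proof -
    have "D integrable_on {0..real n}"
      by (intro integrable_continuous_real continuous_on_subset[OF cont]) auto
    then have I: "(D has_integral integral {0..real n} D) {0..real n}" by blast
    have "((\<lambda>s. D (- s)) has_integral integral {0..real n} D) {- real n..0}"
      using I has_integral_reflect_real[of D _ "real n" 0] by simp
    \<comment> \<open>At 0 the value of \<open>f\<close> comes from division by zero and may differ
      from \<open>D 0\<close>; a single point is negligible.\<close>
    then have 1: "(f has_integral integral {0..real n} D) {- real n..0}"
      by (rule has_integral_spike[of "{0}", rotated 2]) (use f_neg[of "- _"] in \<open>auto\<close>)
    have "((\<lambda>s. cnj (D s)) has_integral cnj (integral {0..real n} D)) {0..real n}"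
      using has_integral_linear[OF I bounded_linear_cnj] by (simp add: o_def)
    then have 2: "(f has_integral cnj (integral {0..real n} D)) {0..real n}"
      by (rule has_integral_spike[of "{0}", rotated 2]) (auto simp: f_pos)
    show ?thesis
      using has_integral_combine[OF _ _ 1 2] by (simp add: complex_add_cnj)
  qed
  have fm[measurable]: "f \<in> borel_measurable borel"
    unfolding f_def by measurable
  have f_le: "cmod (f t) \<le> x - a" for t
  proof (cases "t = 0")
    case False
    have "cmod (f t) \<le> (x - a) * 1"
      unfolding f_def norm_mult
    proof (rule mult_mono)
      show "cmod ((iexp (- (t * a)) - iexp (- (t * x))) / (\<i> * t)) \<le> x - a"
        using Levy_Inversion_aux2[of a x "- t"] False ax
        by (simp add: norm_divide norm_mult norm_minus_commute)
    qed (use ax cmod_char_le_1 in auto)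
    then show ?thesis by simp
  qed (use ax in \<open>simp add: f_def\<close>)
  have int: "set_integrable lborel {- real n..real n} f" for n
    unfolding set_integrable_def
  proof (rule Bochner_Integration.integrable_bound)
    show "integrable lborel (\<lambda>t. indicator {- real n..real n} t * (x - a))"
      by (intro integrable_mult_left) (simp add: integrable_indicator_iff emeasure_lborel_Icc_eq)
    show "AE t in lborel. norm (indicator {- real n..real n} t *\<^sub>R f t) \<le> norm (indicator {- real n..real n} t * (x - a))"
      using ax f_le by (auto simp: indicator_def)
  qed simp
  have "(CLBINT t=-real n..real n. f t) = of_real (2 * Re (integral {0..real n} D))" for n
    using set_borel_integral_eq_integral(2)[OF int[of n]] hk[of n]
    by (simp add: interval_integral_Icc integral_unique del: of_real_mult)
  moreover have "(\<lambda>n. 1 / (2 * pi) * (CLBINT t=-real n..real n. f t)) \<longlonglongrightarrow> of_real (measure M {a<..x})"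
    using Levy_Inversion[of a x] ax null unfolding f_def by simp
  ultimately have "(\<lambda>n. 1 / (2 * pi) * complex_of_real (2 * Re (integral {0..real n} D))) \<longlonglongrightarrow> of_real (measure M {a<..x})"
    by simp
  from tendsto_Re[OF this] show ?thesis by simp
qed

section \<open>Bounds and limits for the integral over the cut\<close>

text \<open>With \<open>p = 1 / y\<close> the integrand is at most
  \<open>p * exp (m * p powr c - b * x * p)\<close>, which tends to 0 as \<open>p\<close> grows
  because \<open>c < 1\<close>. Uniformity in \<open>x' \<ge> x\<close> is for the later limit in
  \<open>x\<close>.\<close>

lemma norm_cut_integrand_le:
  assumes "0 < A" "0 < b" "0 < c" "c < 1" "0 < x"
  obtains B where "\<And>x' y. x \<le> x' \<Longrightarrow> 0 < y \<Longrightarrow> y < 1 \<Longrightarrow> \<bar>cut_integrand A b c x' y\<bar> \<le> B"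
proof -
  define m where "m = A * b powr c"
  have m: "m > 0" unfolding m_def using assms by simp
  have "((\<lambda>p::real. p * exp (m * p powr c - b * x * p)) \<longlongrightarrow> 0) at_top"
  proof -
    define k where "k = b * x"
    have "k > 0" unfolding k_def using assms by simp
    then show ?thesis unfolding k_def[symmetric] using m assms(3,4) by real_asymp
  qed
  then have "eventually (\<lambda>p. p * exp (m * p powr c - b * x * p) < 1) at_top"
    by (rule order_tendstoD) simp
  then obtain P where P: "\<And>p. p \<ge> P \<Longrightarrow> p * exp (m * p powr c - b * x * p) < 1"
    by (auto simp: eventually_at_top_linorder)
  show thesis
  proof
    fix x' y :: real assume *: "x \<le> x'" "0 < y" "y < 1"
    define p where "p = 1 / y"
    define E where "E = (1 - y) * (1 / y - 1) powr c"
    have p: "p \<ge> 1" unfolding p_def using * by simp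
    have E: "0 \<le> E" "E \<le> p powr c"
    proof -
      have "E \<le> 1 * p powr c"
        unfolding E_def p_def using * assms by (intro mult_mono powr_mono2) auto
      then show "E \<le> p powr c" by simp
    qed (use * in \<open>simp add: E_def\<close>)
    have "- 1 * E \<le> cos (pi * c) * E" using E by (intro mult_right_mono) auto
    then have "- (p powr c) \<le> y + cos (pi * c) * E" using E * by linarith
    from mult_left_mono[OF this, of m] have "- m * (y + cos (pi * c) * E) \<le> m * p powr c" using m by simp
    moreover have "b * x * p \<le> b * x' / y" unfolding p_def using * assms by (simp add: divide_right_mono)
    ultimately have ex: "exp (- m * (y + cos (pi * c) * E) - b * x' / y) \<le> exp (m * p powr c - b * x * p)"
      by simp
    have "\<bar>cut_integrand A b c x' y\<bar> = p * exp (- m * (y + cos (pi * c) * E) - b * x' / y) * \<bar>sin (m * sin (pi * c) * E)\<bar>"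
      unfolding cut_integrand_def p_def E_def m_def using * by (simp add: abs_mult mult.assoc)
    also have "\<dots> \<le> p * exp (m * p powr c - b * x * p) * 1"
      using ex p by (intro mult_mono) auto
    also have "\<dots> \<le> max 1 (P * exp (m * P powr c))"
    proof (cases "p \<ge> P")
      case True
      then show ?thesis using P[of p] by simp
    next
      case False
      have "m * p powr c - b * x * p \<le> m * P powr c"
        using False p m assms powr_mono2[of c p P] by (smt (verit) mult_left_mono mult_nonneg_nonneg)
      then have "p * exp (m * p powr c - b * x * p) \<le> P * exp (m * P powr c)"
        using False p by (intro mult_mono) auto
      then show ?thesis by simp
    qed
    finally show "\<bar>cut_integrand A b c x' y\<bar> \<le> max 1 (P * exp (m * P powr c))" .
  qed
qed

lemma cut_integrand_measurable [measurable]: "cut_integrand A b c x \<in> borel_measurable borel"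
  unfolding cut_integrand_def by measurable

lemma continuous_on_cut_integrand:
  assumes "0 < c"
  shows "continuous_on {0<..1} (cut_integrand A b c x)"
proof -
  have quot: "continuous_on {0<..1} (\<lambda>y::real. r / y)" for r
    by (rule continuous_on_divide[OF continuous_on_const continuous_on_id]) auto
  have "continuous_on {0<..1} (\<lambda>y::real. (1 / y - 1) powr c)"
    by (rule continuous_on_powr'[OF continuous_on_diff[OF quot continuous_on_const] continuous_on_const])
       (use assms in auto)
  then show ?thesis
    unfolding cut_integrand_def
    by (intro continuous_on_mult continuous_on_exp continuous_on_sin continuous_on_diff continuous_on_add
        continuous_on_const continuous_on_id quot)
qed

text \<open>Stated for both limits that occur: domains growing to the unit interval at fixed
  \<open>x\<close>, and points decreasing to \<open>x\<close> on a fixed domain.\<close>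

lemma cut_integrand_dominated:
  assumes "0 < A" "0 < b" "0 < c" "c < 1" "0 < x"
    and "\<And>n. x \<le> x' n" "\<And>n. S n \<in> sets borel"
    and "\<And>y. (\<lambda>n. indicator (S n) y * cut_integrand A b c (x' n) y) \<longlonglongrightarrow> indicator {0<..<1} y * cut_integrand A b c x y"
    and "\<And>n. S n \<subseteq> {0<..1}"
  shows "(\<lambda>n. LBINT y:S n. cut_integrand A b c (x' n) y) \<longlonglongrightarrow> (LBINT y:{0<..<1}. cut_integrand A b c x y)"
proof -
  obtain B where B: "\<And>x' y. x \<le> x' \<Longrightarrow> 0 < y \<Longrightarrow> y < 1 \<Longrightarrow> \<bar>cut_integrand A b c x' y\<bar> \<le> B"
    using norm_cut_integrand_le[OF assms(1-5)] by metis
  have B0: "B \<ge> 0" using order_trans[OF abs_ge_zero B[of x "1 / 2"]] by simp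
  have [measurable]: "S n \<in> sets borel" for n by (rule assms)
  show ?thesis
    unfolding set_lebesgue_integral_def real_scaleR_def
  proof (rule integral_dominated_convergence)
    show "integrable lborel (\<lambda>y. indicator {0..1::real} y * B)"
      by (intro integrable_mult_left) (simp add: integrable_indicator_iff emeasure_lborel_Icc_eq)
    show "AE y in lborel. norm (indicator (S n) y * cut_integrand A b c (x' n) y) \<le> indicator {0..1} y * B" for n
    proof (rule AE_I2)
      fix y :: real
      show "norm (indicator (S n) y * cut_integrand A b c (x' n) y) \<le> indicator {0..1} y * B"
      proof (cases "y \<in> S n")
        case True
        then have y: "0 < y" "y \<le> 1" using assms(9)[of n] by auto
        show ?thesis
        \<comment> \<open>The uniform bound covers only \<open>y < 1\<close>; at 1 the integrand is
          0.\<close>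
        proof (cases "y = 1")
          case True
          then show ?thesis using B0 by (simp add: cut_integrand_def)
        next
          case False
          then show ?thesis using y B[of "x' n" y] assms(6)[of n] by (auto simp: indicator_def)
        qed
      qed (use B0 in simp)
    qed
  qed (use assms(8) in auto)
qed

text \<open>The subtracted 1 and the part of the ray before \<open>- b\<close> contribute only real
  values; \<open>v = b / y\<close> carries the rest, \<open>[b, T]\<close>, to
  \<open>[b / T, 1]\<close>.\<close>

lemma cut_contour_integral:
  assumes par: "0 < A" "0 < b" "0 < c" "c < 1" "0 < x" and T: "b < T"
    and H: "\<And>u. u \<noteq> 0 \<Longrightarrow> H u = (exp (of_real x * u) * avg_transform A b c u - 1) / u"
    and cont: "continuous_on {u. 0 \<le> Im u} H"
  shows "Im (contour_integral (linepath 0 (of_real (- 1 * T))) H)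
     = - exp (A * (c + 1) * b powr c) * (LBINT y:{b / T..1}. cut_integrand A b c x y)"
proof -
  \<comment> \<open>The sign is the direction \<open>- 1\<close> of the ray.\<close>
  define f where "f v = - Im (H (of_real (- v)))" for v :: real
  have T0: "T > 0" using par T by simp
  have f_cont: "continuous_on {0..T} f"
    unfolding f_def by (intro continuous_intros continuous_on_compose2[OF cont]) auto
  have cint: "H contour_integrable_on linepath 0 (- 1 * of_real T)"
    by (intro contour_integrable_continuous_linepath continuous_on_subset[OF cont])
       (auto simp: closed_segment_def)
  have "((\<lambda>s. H (- 1 * of_real s) * - 1) has_integral contour_integral (linepath 0 (- 1 * of_real T)) H) {0..T}"
    by (rule has_integral_contour_ray[OF T0 cint])
  from has_integral_linear[OF this bounded_linear_Im]
  have 1: "(f has_integral Im (contour_integral (linepath 0 (- 1 * of_real T)) H)) {0..T}"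
    by (simp add: f_def[abs_def] o_def)
  have f0: "f v = 0" if "0 < v" "v < b" for v
    using that par Im_avg_transform_real[of b "- v" x A c] by (simp add: f_def H Im_divide_of_real flip: of_real_minus)
  have "(f has_integral 0) {0..b}"
    by (rule has_integral_spike[where S = "{0, b}" and f = "\<lambda>_. 0"]) (use f0 in auto)
  then have "integral {0..T} f = integral {b..T} f"
    using Henstock_Kurzweil_Integration.integral_combine[where a = 0 and c = b and b = T and f = f] integrable_continuous_real[OF f_cont] par T by (simp add: integral_unique)
  then have 2: "Im (contour_integral (linepath 0 (- 1 * of_real T)) H) = integral {b..T} f"
    using 1 by (simp add: integral_unique)
  \<comment> \<open>As \<open>b / y\<close> decreases, the first integral on the right runs over the
    empty \<open>{T..b}\<close> and the second one brings the sign.\<close>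
  have "((\<lambda>y. (- b / y\<^sup>2) *\<^sub>R f (b / y)) has_integral (integral {b / (b / T)..b / 1} f - integral {b / 1..b / (b / T)} f)) {b / T..1}"
  proof (rule has_integral_substitution_general[where s = "{}" and g = "\<lambda>y. b / y" and c = 0 and d = T])
    show "(\<lambda>y. b / y) ` {b / T..1} \<subseteq> {0..T}"
    proof clarify
      fix y assume "y \<in> {b / T..1}"
      moreover have "0 < b / T" using par T0 by simp
      ultimately have "0 < y" "b / T \<le> y" by simp_all
      then show "b / y \<in> {0..T}" using par T0 by (simp add: pos_divide_le_eq mult.commute)
    qed
    show "continuous_on {b / T..1} (\<lambda>y. b / y)"
    proof (intro continuous_on_divide continuous_on_const continuous_on_id ballI)
      fix y assume "y \<in> {b / T..1}"
      moreover have "0 < b / T" using par T0 by simp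
      ultimately show "y \<noteq> 0" by auto
    qed
    show "((\<lambda>y. b / y) has_field_derivative - b / y\<^sup>2) (at y within {b / T..1})" if "y \<in> {b / T..1} - {}" for y
    proof -
      have "0 < b / T" using par T0 by simp
      then have "y \<noteq> 0" using that by auto
      then show ?thesis by (auto intro!: derivative_eq_intros simp: power2_eq_square)
    qed
  qed (use par T f_cont in auto)
  then have 3: "((\<lambda>y. (- b / y\<^sup>2) *\<^sub>R f (b / y)) has_integral - integral {b..T} f) {b / T..1}"
    using par T by simp
  \<comment> \<open>The excluded \<open>y = 1\<close> is the branch point
    \<open>u = - b\<close>.\<close>
  have eq: "exp (A * (c + 1) * b powr c) * cut_integrand A b c x y = (- b / y\<^sup>2) *\<^sub>R f (b / y)"
    if y: "y \<in> {b / T..1} - {1}" for y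
  proof -
    have "0 < b / T" using par T0 by simp
    then have y: "0 < y" "y < 1" using y by auto
    define e where "e = exp (of_real x * of_real (- (b / y))) * avg_transform A b c (of_real (- (b / y)))"
    have "complex_of_real (- (b / y)) \<noteq> 0" using y par by simp
    then have "H (of_real (- (b / y))) = (e - 1) / of_real (- (b / y))" unfolding e_def by (rule H)
    moreover have "Im ((e - 1) / of_real (- (b / y))) = - (Im e / (b / y))"
      unfolding Im_divide_of_real by simp
    ultimately have f: "f (b / y) = Im e / (b / y)" unfolding f_def by simp
    have "(- b / y\<^sup>2) *\<^sub>R f (b / y) = - (1 / y * Im e)"
      unfolding f using y par by (simp add: field_simps power2_eq_square)
    then show ?thesis using Im_avg_transform_cut[OF y par(2), of x A c] by (simp add: e_def)
  qed
  have 4: "((\<lambda>y. exp (A * (c + 1) * b powr c) * cut_integrand A b c x y) has_integral - integral {b..T} f) {b / T..1}"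
    by (rule has_integral_spike[OF negligible_sing eq 3])
  have "set_integrable lborel {b / T..1} (cut_integrand A b c x)"
    unfolding set_integrable_def
  proof (rule borel_integrable_compact)
    have "0 < b / T" using par T0 by simp
    then have "{b / T..1} \<subseteq> {0<..1}" by auto
    then show "continuous_on {b / T..1} (cut_integrand A b c x)"
      by (rule continuous_on_subset[OF continuous_on_cut_integrand[OF par(3)]])
  qed simp
  note I = set_borel_integral_eq_integral[OF this]
  have "(cut_integrand A b c x has_integral (LBINT y:{b / T..1}. cut_integrand A b c x y)) {b / T..1}"
    unfolding I(2) by (rule integrable_integral[OF I(1)])
  then have "((\<lambda>y. exp (A * (c + 1) * b powr c) * cut_integrand A b c x y) has_integral
      exp (A * (c + 1) * b powr c) * (LBINT y:{b / T..1}. cut_integrand A b c x y)) {b / T..1}"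
    by (rule has_integral_mult_right)
  from has_integral_unique[OF 4 this] show ?thesis using 2 by simp
qed

text \<open>Two recurrence steps give \<open>Gamma (1 - c) = c * (c + 1) * Gamma (- c - 1)\<close>.
  Positivity makes \<open>A > 0\<close>, on which all growth bounds rest.\<close>

lemma Gamma_negative_argument:
  fixes c :: real
  assumes "0 < c" "c < 1"
  shows "Gamma (- c) = (- c - 1) * Gamma (- c - 1)" and "0 < Gamma (- c - 1)"
proof -
  have "- c \<notin> \<int>"
  proof
    assume "- c \<in> \<int>"
    then obtain n where "- c = of_int n" by (rule Ints_cases)
    then have "real_of_int n < of_int 0" "of_int (- 1) < real_of_int n" using assms by simp_all
    then have "n < 0" "- 1 < n" by (simp_all only: of_int_less_iff)
    then show False by simp
  qed
  moreover from this have "- c - 1 \<notin> \<int>"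
    using Ints_add[of "- c - 1" 1] by auto
  ultimately have "- c \<notin> \<int>\<^sub>\<le>\<^sub>0" "- c - 1 \<notin> \<int>\<^sub>\<le>\<^sub>0"
    using nonpos_Ints_subset_Ints by auto
  then have G: "Gamma (- c) = (- c - 1) * Gamma (- c - 1)" "Gamma (1 - c) = - c * Gamma (- c)"
    using Gamma_plus1[of "- c - 1"] Gamma_plus1[of "- c"] by simp_all
  show "Gamma (- c) = (- c - 1) * Gamma (- c - 1)" by (fact G)
  have "Gamma (1 - c) = c * (c + 1) * Gamma (- c - 1)"
    unfolding G(2) unfolding G(1) by (simp add: algebra_simps)
  moreover have "Gamma (1 - c) > 0" using assms by (intro Gamma_real_pos) simp
  moreover have "c * (c + 1) > 0" using assms by simp
  ultimately show "0 < Gamma (- c - 1)" by (metis zero_less_mult_pos)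
qed

section \<open>The distribution function of the average\<close>

context tempered_stable_subordinator
begin

text \<open>The factor \<open>1 / (c + 1)\<close> from integrating the power is absorbed by the
  Gamma recurrence, which also flips the sign.\<close>

lemma char_running_average_eq:
  assumes "t > 0" "s \<noteq> 0"
  shows "char (distr M borel (running_average X t)) (- s) = avg_transform (a * t * Gamma (- c - 1)) b c (\<i> * s)"
proof -
  note G = Gamma_negative_argument(1)[OF c_pos c_less_1]
  define m k where "m = complex_of_real (c + 1)" and "k = complex_of_real (a * t * Gamma (- c - 1))"
  have m0: "m \<noteq> 0" unfolding m_def using c_pos by (simp only: of_real_eq_0_iff)
  have mk: "of_real (a * t * Gamma (- c)) = - (m * k)"
    unfolding m_def k_def G by (simp flip: of_real_mult of_real_minus of_real_add) (simp add: algebra_simps)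
  have "- (m * k) * (z - r) = k * (m * r - m * z)" for z r :: complex
    by (simp add: algebra_simps)
  from this[of "_ / (m * _)"] m0
  have *: "of_real (a * t * Gamma (- c)) * (q / (m * w) - of_real r) = k * (of_real ((c + 1) * r) - q / w)"
    for q w :: complex and r
    unfolding mk by (simp add: m_def)
  have "of_real b powr complex_of_real p = of_real (b powr p)" for p
    using b_pos by (simp add: powr_of_real)
  from this[of c] this[of "c + 1"] show ?thesis
    using char_running_average[OF assms(1), of "- s"] assms(2)
    unfolding avg_transform_def k_def[symmetric] *[symmetric] m_def by simp
qed

lemma AE_running_average_nonneg:
  assumes "t > 0"
  shows "AE \<omega> in M. 0 \<le> running_average X t \<omega>"
proof -
  have "AE \<omega> in M. \<omega> \<in> space M" by simp
  with X_start show ?thesis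
  proof eventually_elim
    fix \<omega> assume \<omega>: "X 0 \<omega> = 0" "\<omega> \<in> space M"
    have "0 \<le> X s \<omega>" if "0 \<le> s" for s
      using nondecreasing_paths[OF \<omega>(2)] that \<omega>(1) by (auto simp: mono_on_def dest: spec[of _ 0])
    then show "0 \<le> running_average X t \<omega>"
      unfolding running_average_def set_lebesgue_integral_def using assms
      by (intro mult_nonneg_nonneg Bochner_Integration.integral_nonneg) (auto simp: indicator_def)
  qed
qed

text \<open>In the limit the path of \<open>H\<close> yields \<pi> / 2 minus the cut integral with
  its prefactor, that of \<open>L\<close> yields - \<pi> / 2 and nothing from the real axis. The
  difference divided by \<pi> is the claim.\<close>

lemma cdf_running_average_continuity_point:
  assumes t: "t > 0" and x: "x > 0"
    and null: "measure (distr M borel (running_average X t)) {x} = 0"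
  defines "A \<equiv> a * t * Gamma (- c - 1)"
  shows "cdf (distr M borel (running_average X t)) x =
     1 - exp (A * (c + 1) * b powr c) / pi * (LBINT y:{0<..<1}. cut_integrand A b c x y)"
proof -
  let ?N = "distr M borel (running_average X t)"
  have [measurable]: "running_average X t \<in> borel_measurable M"
    by (rule running_average_measurable[OF t])
  interpret N: real_distribution ?N
    by (rule real_distribution_distr) simp
  have A: "A > 0"
    unfolding A_def using a_pos t Gamma_negative_argument(2)[OF c_pos c_less_1] by simp
  note par = A b_pos c_pos c_less_1
  obtain H where H: "\<And>u. u \<noteq> 0 \<Longrightarrow> H u = (exp (of_real x * u) * avg_transform A b c u - 1) / u"
    and H_cont: "continuous_on {u. 0 \<le> Im u} H"
    and H_diff: "\<And>u. 0 < Im u \<Longrightarrow> H field_differentiable at u"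
    using avg_transform_quotient_extension[OF c_pos b_pos, of x A] by metis
  obtain L where L: "\<And>u. u \<noteq> 0 \<Longrightarrow> L u = (exp (of_real (- 1) * u) * avg_transform A b c u - 1) / u"
    and L_cont: "continuous_on {u. 0 \<le> Im u} L"
    and L_diff: "\<And>u. 0 < Im u \<Longrightarrow> L field_differentiable at u"
    using avg_transform_quotient_extension[OF c_pos b_pos, of "- 1" A] by metis
  define K where "K = exp (A * ((c + 1) * b powr c + b * (2 + b) + b powr (c + 1)))"
  obtain N where N: "\<And>u. Re u \<le> 0 \<Longrightarrow> 0 \<le> Im u \<Longrightarrow> N \<le> cmod u \<Longrightarrow>
     cmod (exp (of_real x * u) * avg_transform A b c u) \<le> K * exp (- (x / 2) * \<bar>Re u\<bar>)"
    using norm_avg_transform_left[OF c_pos c_less_1 b_pos A x] unfolding K_def by metis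
  define hI where "hI F T = contour_integral (linepath 0 (\<i> * complex_of_real T)) F" for F T
  define hR where "hR F T = contour_integral (linepath 0 (complex_of_real T)) F" for F T
  have limH: "((\<lambda>T. hI H T - hR H (- 1 * T)) \<longlongrightarrow> - \<i> * of_real (- 1) * pi / 2) at_top"
    unfolding hI_def hR_def
  proof (rule quadrant_contour_limit)
    show "continuous_on {z. 0 \<le> - 1 * Re z \<and> 0 \<le> Im z} H"
      by (rule continuous_on_subset[OF H_cont]) auto
    show "cmod (exp (of_real x * z) * avg_transform A b c z) \<le> K * exp (- (x / 2) * \<bar>Re z\<bar>)"
      if "0 \<le> - 1 * Re z" "0 \<le> Im z" "N \<le> cmod z" for z
      using that by (intro N) auto
  qed (use x H H_diff in auto)
  have limL: "((\<lambda>T. hI L T - hR L (1 * T)) \<longlongrightarrow> - \<i> * of_real 1 * pi / 2) at_top"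
    unfolding hI_def hR_def
  proof (rule quadrant_contour_limit)
    show "continuous_on {z. 0 \<le> 1 * Re z \<and> 0 \<le> Im z} L"
      by (rule continuous_on_subset[OF L_cont]) auto
    show "cmod (exp (of_real (- 1) * z) * avg_transform A b c z) \<le> K * exp (- 1 * \<bar>Re z\<bar>)"
      if "0 \<le> 1 * Re z" "0 \<le> Im z" "1 \<le> cmod z" for z
    proof -
      have "cmod (exp (of_real (- 1) * z)) = exp (- 1 * \<bar>Re z\<bar>)" using that by simp
      moreover have "cmod (avg_transform A b c z) \<le> K"
        unfolding K_def using that par by (intro norm_avg_transform_right) auto
      ultimately show ?thesis unfolding norm_mult by (simp add: mult.commute)
    qed
  qed (use L L_diff in auto)
  have sub: "closed_segment 0 (complex_of_real T) \<subseteq> {u. 0 \<le> Im u}" for T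
    by (auto simp: closed_segment_def)
  have subI: "closed_segment 0 (\<i> * complex_of_real T) \<subseteq> {u. 0 \<le> Im u}" if "T > 0" for T
    using that by (auto simp: closed_segment_def)
  have L_real: "Im (hR L T) = 0" if T: "T > 0" for T
  proof -
    have "L contour_integrable_on linepath 0 (1 * of_real T)"
      using sub[of T] by (intro contour_integrable_continuous_linepath continuous_on_subset[OF L_cont]) simp
    from has_integral_linear[OF has_integral_contour_ray[OF T this] bounded_linear_Im]
    have 1: "((\<lambda>s. Im (L (of_real s))) has_integral Im (hR L T)) {0..T}"
      by (simp add: o_def hR_def)
    have "((\<lambda>s. Im (L (of_real s))) has_integral 0) {0..T}"
    proof (rule has_integral_spike[where S = "{0}" and f = "\<lambda>_. 0"])
      fix s assume s: "s \<in> {0..T} - {0}"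
      then have "Im (exp (of_real (- 1) * of_real s) * avg_transform A b c (of_real s)) = 0"
        using b_pos by (intro Im_avg_transform_real) auto
      then show "Im (L (of_real s)) = 0" using s by (simp add: L Im_divide_of_real)
    qed auto
    with 1 show ?thesis by (rule has_integral_unique)
  qed
  \<comment> \<open>The subtracted \<open>1 / u\<close> cancels between \<open>H\<close> and
    \<open>L\<close>, which leaves the inversion integrand, continuous at 0 as well.\<close>
  define D where "D s = H (\<i> * complex_of_real s) - L (\<i> * complex_of_real s)" for s
  have D_cont: "continuous_on {0..} D"
    unfolding D_def
    by (intro continuous_intros continuous_on_compose2[OF H_cont] continuous_on_compose2[OF L_cont]) auto
  have Re_D: "Re (integral {0..T} D) = Im (hI H T) - Im (hI L T)" if T: "T > 0" for T
  proof -
    have "H contour_integrable_on linepath 0 (\<i> * of_real T)" "L contour_integrable_on linepath 0 (\<i> * of_real T)"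
      using subI[OF T] by (auto intro!: contour_integrable_continuous_linepath
        continuous_on_subset[OF H_cont] continuous_on_subset[OF L_cont])
    from this[THEN has_integral_contour_ray[OF T]]
    have "((\<lambda>s. H (\<i> * of_real s) * \<i> - L (\<i> * of_real s) * \<i>) has_integral (hI H T - hI L T)) {0..T}"
      unfolding hI_def by (rule has_integral_diff)
    then have 1: "((\<lambda>s. D s * \<i>) has_integral (hI H T - hI L T)) {0..T}"
      by (simp add: D_def left_diff_distrib)
    have "D integrable_on {0..T}"
      by (intro integrable_continuous_real continuous_on_subset[OF D_cont]) auto
    then have "((\<lambda>s. D s * \<i>) has_integral (integral {0..T} D * \<i>)) {0..T}"
      by (intro has_integral_mult_left) blast
    from has_integral_unique[OF this 1] have "Im (integral {0..T} D * \<i>) = Im (hI H T - hI L T)" by simp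
    then show ?thesis by simp
  qed
  have AE0: "AE r in ?N. 0 \<le> r"
    using AE_running_average_nonneg[OF t] by (simp add: AE_distr_iff)
  have "measure ?N {- 1} = measure ?N {}"
    using AE0 by (intro measure_eq_AE) auto
  then have null1: "measure ?N {- 1} = 0" by simp
  have cdf: "cdf ?N x = measure ?N {- 1<..x}"
    unfolding cdf_def using AE0 by (intro measure_eq_AE) auto
  have lim1: "(\<lambda>n. Re (integral {0..real n} D) / pi) \<longlonglongrightarrow> cdf ?N x"
    unfolding cdf
  proof (rule N.Levy_Inversion_half_line)
    fix s :: real assume s: "s > 0"
    then have "D s = (exp (of_real x * (\<i> * s)) - exp (of_real (- 1) * (\<i> * s))) / (\<i> * s) * avg_transform A b c (\<i> * s)"
      unfolding D_def by (subst H, simp, subst L, simp) (simp add: field_simps)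
    then show "D s = (iexp (s * x) - iexp (s * - 1)) / (\<i> * s) * char ?N (- s)"
      using char_running_average_eq[OF t, of s] s unfolding A_def by (simp add: mult_ac)
  qed (use x null null1 D_cont in auto)
  let ?E = "exp (A * (c + 1) * b powr c)"
  let ?J = "LBINT y:{0<..<1}. cut_integrand A b c x y"
  have n_top: "filterlim real at_top sequentially" by (rule filterlim_real_sequentially)
  \<comment> \<open>The intersection removes the point 0 in the case \<open>n = 0\<close>, where
    \<open>b / real n = 0\<close>.\<close>
  have "(\<lambda>n. LBINT y:{b / real n..1} \<inter> {0<..1}. cut_integrand A b c x y) \<longlonglongrightarrow> ?J"
  proof (rule cut_integrand_dominated[OF par x])
    fix y :: real
    show "(\<lambda>n. indicator ({b / real n..1} \<inter> {0<..1}) y * cut_integrand A b c x y) \<longlonglongrightarrow> indicator {0<..<1} y * cut_integrand A b c x y"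
    proof (cases "0 < y \<and> y < 1")
      case True
      have "((\<lambda>n. b / real n) \<longlongrightarrow> 0) sequentially" by (rule lim_const_over_n)
      then have "eventually (\<lambda>n. b / real n < y) sequentially"
        using True by (intro order_tendstoD(2)) auto
      then have "eventually (\<lambda>n. indicator ({b / real n..1} \<inter> {0<..1}) y * cut_integrand A b c x y
          = indicator {0<..<1} y * cut_integrand A b c x y) sequentially"
        by eventually_elim (use True in simp)
      then show ?thesis by (rule tendsto_eventually)
    next
      case False
      then have "indicator ({b / real n..1} \<inter> {0<..1}) y * cut_integrand A b c x y = 0" for n
        by (cases "y = 1") (auto simp: indicator_def cut_integrand_def)
      moreover have "indicator {0<..<1} y * cut_integrand A b c x y = 0" using False by simp
      ultimately show ?thesis by (simp only: tendsto_const)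
    qed
  qed auto
  then have "(\<lambda>n. - ?E * (LBINT y:{b / real n..1} \<inter> {0<..1}. cut_integrand A b c x y)) \<longlonglongrightarrow> - ?E * ?J"
    by (intro tendsto_intros)
  moreover have "eventually (\<lambda>n. - ?E * (LBINT y:{b / real n..1} \<inter> {0<..1}. cut_integrand A b c x y) = Im (hR H (- 1 * real n))) sequentially"
  proof -
    have "eventually (\<lambda>n. b < real n) sequentially"
      using n_top by (simp add: filterlim_at_top_dense)
    then show ?thesis
    proof eventually_elim
      case (elim n)
      then have "0 < b / real n" using b_pos by simp
      then have "{b / real n..1} \<inter> {0<..1} = {b / real n..1}" by auto
      then show ?case unfolding hR_def using cut_contour_integral[OF par x elim H H_cont] by simp
    qed
  qed
  ultimately have lim2: "(\<lambda>n. Im (hR H (- 1 * real n))) \<longlonglongrightarrow> - ?E * ?J"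
    by (rule Lim_transform_eventually)
  have lim3: "(\<lambda>n. Im (hI H (real n) - hR H (- 1 * real n)) + Im (hR H (- 1 * real n))
       - Im (hI L (real n) - hR L (1 * real n))) \<longlonglongrightarrow> Im (- \<i> * of_real (- 1) * pi / 2) + - ?E * ?J - Im (- \<i> * of_real 1 * pi / 2)"
    by (intro tendsto_intros lim2 filterlim_compose[OF limH n_top] filterlim_compose[OF limL n_top])
  have "(\<lambda>n. Re (integral {0..real n} D) / pi) \<longlonglongrightarrow> (pi / 2 + - ?E * ?J + pi / 2) / pi"
  proof (rule Lim_transform_eventually)
    show "eventually (\<lambda>n. (Im (hI H (real n) - hR H (- 1 * real n)) + Im (hR H (- 1 * real n))
       - Im (hI L (real n) - hR L (1 * real n))) / pi = Re (integral {0..real n} D) / pi) sequentially"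
      using eventually_gt_at_top[of 0] by eventually_elim (simp add: Re_D L_real)
    show "(\<lambda>n. (Im (hI H (real n) - hR H (- 1 * real n)) + Im (hR H (- 1 * real n))
       - Im (hI L (real n) - hR L (1 * real n))) / pi) \<longlonglongrightarrow> (pi / 2 + - ?E * ?J + pi / 2) / pi"
      using tendsto_divide[OF lim3 tendsto_const[of pi]] by simp
  qed
  from LIMSEQ_unique[OF lim1 this] show ?thesis by (simp add: field_simps)
qed

lemma cdf_running_average:
  assumes t: "t > 0" and x: "x > 0"
  defines "A \<equiv> a * t * Gamma (- c - 1)"
  shows "cdf (distr M borel (running_average X t)) x =
     1 - exp (A * (c + 1) * b powr c) / pi * (LBINT y:{0<..<1}. cut_integrand A b c x y)"
proof -
  let ?N = "distr M borel (running_average X t)"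
  have [measurable]: "running_average X t \<in> borel_measurable M"
    by (rule running_average_measurable[OF t])
  interpret N: real_distribution ?N
    by (rule real_distribution_distr) simp
  have A: "A > 0"
    unfolding A_def using a_pos t Gamma_negative_argument(2)[OF c_pos c_less_1] by simp
  \<comment> \<open>A finite measure has countably many atoms, so points without mass exist
    arbitrarily close to the right of \<open>x\<close>.\<close>
  have "\<exists>z\<in>{x<..<x + 1 / real (Suc n)}. z \<notin> {r. measure ?N {r} \<noteq> 0}" for n
    by (rule real_interval_avoid_countable_set[OF _ N.countable_support]) simp
  then have "\<forall>n. \<exists>z. x < z \<and> z < x + 1 / real (Suc n) \<and> measure ?N {z} = 0"
    unfolding Bex_def greaterThanLessThan_iff mem_Collect_eq not_not conj_assoc by blast
  from choice[OF this] obtain z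
    where z: "\<And>n. x < z n" "\<And>n. z n < x + 1 / real (Suc n)" "\<And>n. measure ?N {z n} = 0"
    by blast
  have z_lim: "z \<longlonglongrightarrow> x"
  proof (rule tendsto_sandwich[where f = "\<lambda>_. x" and h = "\<lambda>n. x + 1 / real (Suc n)"])
    show "(\<lambda>n. x + 1 / real (Suc n)) \<longlonglongrightarrow> x"
      using tendsto_add[OF tendsto_const[of x] LIMSEQ_inverse_real_of_nat] by (simp add: divide_inverse)
    show "\<forall>\<^sub>F n in sequentially. z n \<le> x + 1 / real (Suc n)" "\<forall>\<^sub>F n in sequentially. x \<le> z n"
      using z(1,2) by (intro always_eventually allI less_imp_le; simp)+
  qed simp
  have z_right: "filterlim z (at_right x) sequentially"
    using z(1) by (intro tendsto_imp_filterlim_at_right[OF z_lim] always_eventually) simp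
  have cdf_lim: "(cdf ?N \<longlongrightarrow> cdf ?N x) (at_right x)"
    using N.cdf_is_right_cont[of x] by (simp add: continuous_within)
  have lim1: "(\<lambda>n. cdf ?N (z n)) \<longlonglongrightarrow> cdf ?N x"
    by (rule filterlim_compose[OF cdf_lim z_right])
  have eq: "cdf ?N (z n) = 1 - exp (A * (c + 1) * b powr c) / pi * (LBINT y:{0<..<1}. cut_integrand A b c (z n) y)" for n
    unfolding A_def using x z(1)[of n] by (intro cdf_running_average_continuity_point t z(3)) simp
  have lim2: "(\<lambda>n. 1 - exp (A * (c + 1) * b powr c) / pi * (LBINT y:{0<..<1}. cut_integrand A b c (z n) y))
     \<longlonglongrightarrow> 1 - exp (A * (c + 1) * b powr c) / pi * (LBINT y:{0<..<1}. cut_integrand A b c x y)"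
  proof (rule tendsto_diff[OF tendsto_const tendsto_mult[OF tendsto_const
        cut_integrand_dominated[OF A b_pos c_pos c_less_1 x]]])
    show "(\<lambda>n. indicator {0<..<1} y * cut_integrand A b c (z n) y) \<longlonglongrightarrow> indicator {0<..<1} y * cut_integrand A b c x y" for y
    proof (cases "y = 0")
      case False
      then show ?thesis
        unfolding cut_integrand_def
        by (rule tendsto_mult[OF tendsto_const tendsto_mult[OF tendsto_mult[OF tendsto_const
            tendsto_exp[OF tendsto_diff[OF tendsto_const tendsto_divide[OF tendsto_mult[OF tendsto_const z_lim]
            tendsto_const]]]] tendsto_const]])
    qed simp
  qed (use less_imp_le[OF z(1)] in auto)
  show ?thesis
    using lim1 lim2 unfolding eq by (rule LIMSEQ_unique)
qed

end

theorem theorem3: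
  fixes M :: "'w measure" and X :: "real \<Rightarrow> 'w \<Rightarrow> real" and a b c t x :: real
  assumes "a > 0" and "b > 0" and "0 < c" and "c < 1"
    and "tempered_stable_subordinator M X a b c"
    and "t > 0" and "x > 0"
  shows "measure M {\<omega> \<in> space M. running_average X t \<omega> \<le> x} =
    1 - exp (- a * t * b powr c * Gamma (- c)) / pi *
      (LBINT y:{0<..<1}.
         1 / y *
         exp (- a * t * b powr c * Gamma (- c - 1) *
                (y + cos (pi * c) * (1 - y) * (1 / y - 1) powr c) - b * x / y) *
         sin (a * t * b powr c * sin (pi * c) * Gamma (- c - 1) *
                (1 - y) * (1 / y - 1) powr c))"
proof -
  interpret tempered_stable_subordinator M X a b c by fact
  let ?A = "a * t * Gamma (- c - 1)"
  have [measurable]: "running_average X t \<in> borel_measurable M"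
    by (rule running_average_measurable[OF \<open>t > 0\<close>])
  have "cdf (distr M borel (running_average X t)) x = measure M (running_average X t -` {..x} \<inter> space M)"
    unfolding cdf_def by (rule measure_distr) simp_all
  also have "running_average X t -` {..x} \<inter> space M = {\<omega> \<in> space M. running_average X t \<omega> \<le> x}"
    by auto
  finally have "measure M {\<omega> \<in> space M. running_average X t \<omega> \<le> x} =
     1 - exp (?A * (c + 1) * b powr c) / pi * (LBINT y:{0<..<1}. cut_integrand ?A b c x y)"
    using cdf_running_average[OF \<open>t > 0\<close> \<open>x > 0\<close>] by simp
  \<comment> \<open>The value of the transform's constant factor becomes the prefactor of the claim,
    by \<open>Gamma (- c) = - (c + 1) * Gamma (- c - 1)\<close>.\<close>
  moreover have "?A * (c + 1) * b powr c = - a * t * b powr c * Gamma (- c)"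
    unfolding Gamma_negative_argument(1)[OF \<open>0 < c\<close> \<open>c < 1\<close>] by (simp add: algebra_simps)
  moreover have "cut_integrand ?A b c x y = 1 / y *
         exp (- a * t * b powr c * Gamma (- c - 1) *
                (y + cos (pi * c) * (1 - y) * (1 / y - 1) powr c) - b * x / y) *
         sin (a * t * b powr c * sin (pi * c) * Gamma (- c - 1) *
                (1 - y) * (1 / y - 1) powr c)" for y
    unfolding cut_integrand_def by (simp only: mult_ac mult_minus_left mult_minus_right)
  ultimately show ?thesis by (simp only:)
qed

end
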